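(* For the Poisson $i\mathcal{S}$-graph with colluding eavesdroppers, legitimate-node density $\lambda_\ell>0$, eavesdropper density $\lambda_{\mathrm e}>0$, secrecy rate threshold $\varrho=0$, equal noise powers $\sigma_\ell^2=\sigma_{\mathrm e}^2$, and channel gain function $g(r)=\frac1{r^{2b}}$, $b>1$, the average degrees of a typical node are $$\mathbb{E}\{N_{\mathrm{in}}\}=\mathbb{E}\{N_{\mathrm{out}}\}=\frac{\lambda_\ell}{\lambda_{\mathrm e}}\,\mathrm{sinc}\left(\frac1b\right),$$ where $\mathrm{sinc}(x)=\frac{\sin(\pi x)}{\pi x}$.
   Context: $\Pi_\ell$ (legitimate nodes) and $\Pi_{\mathrm e}$ (eavesdroppers) are mutually independent homogeneous Poisson point processes on $\mathbb{R}^2$ with densities $\lambda_\ell,\lambda_{\mathrm e}$. The transmit power is $P_\ell>0$, and propagation is path loss only. $i\mathcal{S}$-graph with colluding eavesdroppers: the directed graph on the legitimate nodes with edge $\overrightarrow{xy}$ ($x\ne y$) if and only if $\mathcal{R}_{\mathrm s}(x,y)>\varrho$, where $$\mathcal{R}_{\mathrm s}(x,y)=\left[\log_{2}\left(1+\frac{P_\ell\, g(|x-y|)}{\sigma_\ell^2}\right)-\log_{2}\left(1+\frac{P_\ell\sum_{e\in\Pi_{\mathrm e}}g(|x-e|)}{\sigma_{\mathrm e}^2}\right)\right]^{+},\qquad [t]^+=\max\{t,0\}.$$ Typical node: the node at the origin when the graph is built on the legitimate-node set $\Pi_\ell\cup\{0\}$ with eavesdroppers $\Pi_{\mathrm e}$.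 $N_{\mathrm{out}}$ (resp. $N_{\mathrm{in}}$) is the number of $x\in\Pi_\ell$ with an edge $\overrightarrow{0x}$ (resp. $\overrightarrow{x0}$). *)

theory Defs
  imports "HOL-Probability.Probability"
begin

type_synonym point = "real ^ 2"

definition locally_finite :: "point set \<Rightarrow> bool" where
  "locally_finite S \<longleftrightarrow> (\<forall>B. bounded B \<longrightarrow> finite (S \<inter> B))"

text \<open>
  A simple point process is a random locally finite set, i.e. a random element of the space of
  locally finite configurations, whose sigma-algebra is generated by the counts in bounded Borel
  sets.
\<close>

definition configurations :: "point set measure" where
  "configurations = sigma {S. locally_finite S}
     {{S. locally_finite S \<and> card (S \<inter> B) = n} | B n. B \<in> sets borel \<and> bounded B}"

text \<open>
  The probabilities are written out rather than taken from \<^const>\<open>poisson_pmf\<close>, which is meant for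
  positive rates only: for null sets the formula gives the count 0 with probability 1.
\<close>

definition (in prob_space) poisson_point_process :: "real \<Rightarrow> ('a \<Rightarrow> point set) \<Rightarrow> bool" where
  "poisson_point_process lam \<Phi> \<longleftrightarrow>
     random_variable configurations \<Phi> \<and>
     (\<forall>B n. B \<in> sets borel \<longrightarrow> bounded B \<longrightarrow>
        prob {\<omega> \<in> space M. card (\<Phi> \<omega> \<inter> B) = n} =
          (lam * measure lborel B) ^ n / fact n * exp (- (lam * measure lborel B))) \<and>
     (\<forall>(B :: nat \<Rightarrow> point set) k.
        (\<forall>i<k. B i \<in> sets borel \<and> bounded (B i)) \<longrightarrow> disjoint_family_on B {..<k} \<longrightarrow>
        indep_vars (\<lambda>_. count_space UNIV) (\<lambda>i \<omega>. card (\<Phi> \<omega> \<inter> B i)) {..<k})"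

text \<open>
  Gains and signal-to-noise ratios are extended nonnegative reals, because the gain may be
  infinite at distance 0 and the sum over the eavesdroppers may diverge.  Accordingly
  \<open>log\<^sub>2 (1 + \<infinity>) = \<infinity>\<close>.  In the difference below the first term is finite whenever the gain from
  \<open>x\<close> to \<open>y\<close> is, so the convention for \<open>\<infinity> - \<infinity>\<close> plays no role there.
\<close>

definition capacity :: "ennreal \<Rightarrow> ereal" where
  "capacity s = (if s = \<infinity> then \<infinity> else ereal (log 2 (1 + enn2real s)))"

definition secrecy_rate ::
  "(real \<Rightarrow> ennreal) \<Rightarrow> real \<Rightarrow> real \<Rightarrow> real \<Rightarrow> point set \<Rightarrow> point \<Rightarrow> point \<Rightarrow> ereal" where
  "secrecy_rate g P \<sigma>l \<sigma>e E x y =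
     max (capacity (ennreal P * g (dist x y) / ennreal (\<sigma>l\<^sup>2))
          - capacity (ennreal P * (\<Sum>\<^sub>\<infinity>e\<in>E. g (dist x e)) / ennreal (\<sigma>e\<^sup>2))) 0"

text \<open>The edge set of the graph with node set \<open>L\<close> and colluding eavesdroppers \<open>E\<close>.\<close>

definition iS_graph ::
  "(real \<Rightarrow> ennreal) \<Rightarrow> real \<Rightarrow> real \<Rightarrow> real \<Rightarrow> real \<Rightarrow> point set \<Rightarrow> point set \<Rightarrow> (point \<times> point) set" where
  "iS_graph g P \<sigma>l \<sigma>e \<rho> L E =
     {(x, y). x \<in> L \<and> y \<in> L \<and> x \<noteq> y \<and> secrecy_rate g P \<sigma>l \<sigma>e E x y > ereal \<rho>}"

text \<open>
  Degrees of the node at the origin once it is added to \<open>L\<close>; counting measure is used instead of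
  \<^const>\<open>card\<close> so that an infinite degree is counted as \<open>\<infinity>\<close>, not as 0.
\<close>

definition N_out ::
  "(real \<Rightarrow> ennreal) \<Rightarrow> real \<Rightarrow> real \<Rightarrow> real \<Rightarrow> real \<Rightarrow> point set \<Rightarrow> point set \<Rightarrow> ennreal" where
  "N_out g P \<sigma>l \<sigma>e \<rho> L E =
     emeasure (count_space UNIV) {x \<in> L. (0, x) \<in> iS_graph g P \<sigma>l \<sigma>e \<rho> (L \<union> {0}) E}"

definition N_in ::
  "(real \<Rightarrow> ennreal) \<Rightarrow> real \<Rightarrow> real \<Rightarrow> real \<Rightarrow> real \<Rightarrow> point set \<Rightarrow> point set \<Rightarrow> ennreal" where
  "N_in g P \<sigma>l \<sigma>e \<rho> L E =
     emeasure (count_space UNIV) {x \<in> L. (x, 0) \<in> iS_graph g P \<sigma>l \<sigma>e \<rho> (L \<union> {0}) E}"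

text \<open>In \<^typ>\<open>ennreal\<close>, \<open>1 / 0 = \<infinity>\<close>, so this gain is infinite at distance 0.\<close>

definition power_law_gain :: "real \<Rightarrow> real \<Rightarrow> ennreal" where
  "power_law_gain b r = 1 / ennreal (r powr (2 * b))"

text \<open>The normalized sinc, unlike the unnormalized \<open>sinc\<close> of \<^theory>\<open>HOL-Probability.Sinc_Integral\<close>.\<close>

definition normalized_sinc :: "real \<Rightarrow> real" where
  "normalized_sinc x = sin (pi * x) / (pi * x)"

end

theory Submission
  imports Defs
begin

text \<open>
  Let \<open>S\<^sub>x\<close> be the sum of the gains from \<open>x\<close> to the eavesdroppers.  As the noise powers agree and the
  threshold is \<open>0\<close>, there is an edge from \<open>x\<close> to \<open>y\<close> iff \<open>S\<^sub>x\<close> is less than the gain from \<open>x\<close> to \<open>y\<close>.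
  By Campbell's formula and independence, both average degrees are \<open>\<lambda>\<^sub>l\<close> times an integral over \<open>x\<close> of the
  probability of an edge, and the two integrands agree because the law of \<open>S\<^sub>x\<close> does not depend on \<open>x\<close>.
  For the outgoing edges the integral is the expected area \<open>A\<close> of the disc on which the gain exceeds \<open>S\<^sub>0\<close>.
  Since \<open>\<Gamma>(1 + 1/b) A\<close> is the expectation of the integral of \<open>exp (- |x| powr (2 b) S\<^sub>0)\<close> over the plane,
  the Laplace functional of the Poisson process turns it into the Gaussian integral of
  \<open>exp (- \<lambda>\<^sub>e \<pi> \<Gamma>(1 - 1/b) |x|\<^sup>2)\<close>, and Euler's reflection formula gives the sinc.
\<close>

section \<open>Sums over locally finite configurations\<close>

lemma space_configurations [simp]: "space configurations = {S. locally_finite S}"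
  unfolding configurations_def by (rule space_measure_of) auto

lemma locally_finite_imp_finite: "locally_finite S \<Longrightarrow> bounded B \<Longrightarrow> finite (S \<inter> B)"
  unfolding locally_finite_def by blast

lemma measurable_card_Int:
  assumes "B \<in> sets borel" "bounded B"
  shows "(\<lambda>S. card (S \<inter> B)) \<in> configurations \<rightarrow>\<^sub>M count_space UNIV"
proof (rule measurable_count_space_eq2_countable[THEN iffD2], safe)
  fix n
  have "{S. locally_finite S \<and> card (S \<inter> B) = n} \<in> sets configurations"
    unfolding configurations_def using assms by (subst sets_measure_of) auto
  moreover have "(\<lambda>S. card (S \<inter> B)) -` {n} \<inter> space configurations
      = {S. locally_finite S \<and> card (S \<inter> B) = n}"
    by auto
  ultimately show "(\<lambda>S. card (S \<inter> B)) -` {n} \<inter> space configurations \<in> sets configurations"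
    by simp
qed auto

text \<open>Monotone convergence along growing balls. A ball contains only finitely many points of a
  locally finite set, so this reduces sums over a configuration to suprema of finite sums.\<close>

lemma nn_integral_count_space_ball_SUP:
  fixes h :: "point \<Rightarrow> ennreal"
  shows "(\<integral>\<^sup>+x. h x \<partial>count_space S) =
    (SUP n. \<integral>\<^sup>+x. h x * indicator (ball 0 (real n)) x \<partial>count_space S)"
proof -
  have inc: "incseq (\<lambda>n x. h x * indicator (ball 0 (real n)) x)"
    by (auto simp: incseq_def le_fun_def indicator_def)
  have "(SUP n. h x * indicator (ball 0 (real n)) x) = h x" for x
  proof -
    obtain n :: nat where "norm x < real n"
      using reals_Archimedean2 by blast
    then have "h x \<le> h x * indicator (ball 0 (real n)) x"
      by simp
    then have "h x \<le> (SUP n. h x * indicator (ball 0 (real n)) x)"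
      by (rule SUP_upper2[OF UNIV_I])
    moreover have "(SUP n. h x * indicator (ball 0 (real n)) x) \<le> h x"
      by (intro SUP_least) (auto simp: indicator_def)
    ultimately show ?thesis by simp
  qed
  then show ?thesis
    using nn_integral_monotone_convergence_SUP[OF inc, of "count_space S"] by simp
qed

lemma nn_integral_count_space_bounded:
  fixes h :: "point \<Rightarrow> ennreal"
  assumes "locally_finite S" "bounded B"
  shows "(\<integral>\<^sup>+x. h x * indicator B x \<partial>count_space S) = (\<Sum>x\<in>S \<inter> B. h x)"
proof -
  have "(\<integral>\<^sup>+x. h x * indicator B x \<partial>count_space S) = (\<integral>\<^sup>+x. h x \<partial>count_space (S \<inter> B))"
    by (subst (1 2) nn_integral_count_space_indicator)
       (auto intro!: nn_integral_cong simp: indicator_def)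
  then show ?thesis
    using locally_finite_imp_finite[OF assms] by (simp add: nn_integral_count_space_finite)
qed

text \<open>Links the infinite sum in \<open>secrecy_rate\<close> to an integral, for which monotone
  convergence and Tonelli are available. One direction bounds each finite partial sum by the
  integral; the other uses that the restriction to a ball is itself a finite partial sum.\<close>

lemma infsum_eq_nn_integral_count_space:
  fixes h :: "point \<Rightarrow> ennreal"
  assumes "locally_finite S"
  shows "(\<Sum>\<^sub>\<infinity>x\<in>S. h x) = (\<integral>\<^sup>+x. h x \<partial>count_space S)"
proof (rule antisym)
  have eq: "(\<Sum>\<^sub>\<infinity>x\<in>S. h x) = (SUP F\<in>{F. finite F \<and> F \<subseteq> S}. sum h F)"
    by (rule nonneg_infsum_complete) simp
  show "(\<Sum>\<^sub>\<infinity>x\<in>S. h x) \<le> (\<integral>\<^sup>+x. h x \<partial>count_space S)"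
    unfolding eq
  proof (intro SUP_least, safe)
    fix F assume F: "finite F" "F \<subseteq> S"
    then have "sum h F = (\<integral>\<^sup>+x. h x * indicator F x \<partial>count_space S)"
      by (subst nn_integral_count_space'[of F]) (auto simp: indicator_def)
    also have "\<dots> \<le> (\<integral>\<^sup>+x. h x \<partial>count_space S)"
      by (intro nn_integral_mono) (auto simp: indicator_def)
    finally show "sum h F \<le> (\<integral>\<^sup>+x. h x \<partial>count_space S)" .
  qed
  show "(\<integral>\<^sup>+x. h x \<partial>count_space S) \<le> (\<Sum>\<^sub>\<infinity>x\<in>S. h x)"
    unfolding eq nn_integral_count_space_ball_SUP[of S h]
  proof (intro SUP_least)
    fix n :: nat
    have "finite (S \<inter> ball 0 (real n))"
      using assms by (rule locally_finite_imp_finite) simp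
    then show "(\<integral>\<^sup>+x. h x * indicator (ball 0 (real n)) x \<partial>count_space S)
        \<le> (SUP F\<in>{F. finite F \<and> F \<subseteq> S}. sum h F)"
      using assms by (subst nn_integral_count_space_bounded) (auto intro!: SUP_upper)
  qed
qed

section \<open>Measurability of sums over a random configuration\<close>

text \<open>A Dynkin argument: on a rectangle \<open>a \<times> b\<close> the sum is the indicator
  of \<open>b\<close> times the count in \<open>a \<inter> B\<close>, which is measurable by the
  choice of the sigma-algebra on configurations, and the rectangles form an intersection-stable
  generator of the product.\<close>

lemma measurable_sum_indicator:
  assumes T: "T \<in> N \<rightarrow>\<^sub>M configurations" and A: "A \<in> sets (borel \<Otimes>\<^sub>M N)" and "bounded B" "B \<in> sets borel"
  shows "(\<lambda>c. \<integral>\<^sup>+x. indicator A (x, c) * indicator B x \<partial>count_space (T c)) \<in> borel_measurable N"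
    (is "?I A \<in> _")
proof -
  have lf: "locally_finite (T c)" if "c \<in> space N" for c
    using measurable_space[OF T that] by simp
  \<comment> \<open>Only finitely many points lie in the bounded window \<open>B\<close>, so these
    sums are finite and the complement case below may subtract them.\<close>
  have fin: "?I A c \<noteq> \<infinity>" if "c \<in> space N" for A :: "(point \<times> 'a) set" and c
    by (subst nn_integral_count_space_bounded[OF lf[OF that] \<open>bounded B\<close>])
       (auto simp: locally_finite_imp_finite[OF lf[OF that] \<open>bounded B\<close>] indicator_def)
  have rect: "?I (a \<times> b) \<in> borel_measurable N" if "a \<in> sets borel" "b \<in> sets N" for a b
  proof -
    have ab: "a \<inter> B \<in> sets borel" "bounded (a \<inter> B)"
      using that \<open>B \<in> sets borel\<close> \<open>bounded B\<close> by (auto intro: bounded_subset)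
    have "?I (a \<times> b) c = indicator b c * of_nat (card (T c \<inter> (a \<inter> B)))" if "c \<in> space N" for c
    proof -
      have "?I (a \<times> b) c = (\<integral>\<^sup>+x. indicator b c * indicator (a \<inter> B) x \<partial>count_space (T c))"
        by (auto intro!: nn_integral_cong simp: indicator_def)
      then show ?thesis
        by (subst (asm) nn_integral_count_space_bounded[OF lf[OF that] ab(2)]) (simp add: mult.commute)
    qed
    moreover have "(\<lambda>c. indicator b c * ennreal (real (card (T c \<inter> (a \<inter> B))))) \<in> borel_measurable N"
      using measurable_compose[OF T measurable_card_Int[OF ab]] that(2) by measurable
    ultimately show ?thesis
      by (subst measurable_cong) (auto simp: ennreal_of_nat_eq_real_of_nat)
  qed
  show ?thesis
    using Int_stable_pair_measure_generator pair_measure_closed A unfolding sets_pair_measure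
  proof (induction rule: sigma_sets_induct_disjoint)
    case (basic A)
    then show ?case using rect by auto
  next
    case empty
    then show ?case by simp
  next
    case (compl A)
    have "?I (space borel \<times> space N - A) c = ?I (space borel \<times> space N) c - ?I A c"
      if "c \<in> space N" for c
    proof -
      have "A \<subseteq> space borel \<times> space N"
        using compl(1) sigma_sets_into_sp[OF pair_measure_closed] by blast
      then have "?I (space borel \<times> space N) c = ?I (space borel \<times> space N - A) c + ?I A c"
        by (subst nn_integral_add[symmetric]) (auto intro!: nn_integral_cong simp: indicator_def that)
      then show ?thesis
        using fin[OF that, of A] by simp
    qed
    moreover have "(\<lambda>c. ?I (space borel \<times> space N) c - ?I A c) \<in> borel_measurable N"
      using rect[of "space borel" "space N"] compl(2) by auto
    ultimately show ?case
      by (subst measurable_cong) auto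
  next
    case (union A)
    have "?I (\<Union>i. A i) c = (\<Sum>i. ?I (A i) c)" for c
      by (subst nn_integral_suminf[symmetric])
         (auto intro!: nn_integral_cong simp: suminf_indicator[OF union(1), symmetric])
    then show ?case
      using union by simp
  qed
qed

text \<open>The usual extension from indicators through simple functions to monotone limits; the
  window is removed in the indicator case by exhausting the plane with balls. The summand may depend
  on \<open>c\<close> as well as on the point, which covers the interference at a variable location
  and the dependence on a second configuration.\<close>

lemma measurable_sum_configuration:
  assumes T: "T \<in> N \<rightarrow>\<^sub>M configurations" and f: "f \<in> borel_measurable (borel \<Otimes>\<^sub>M N)"
  shows "(\<lambda>c. \<integral>\<^sup>+x. f (x, c) \<partial>count_space (T c)) \<in> borel_measurable N"
  using f
proof (induction rule: borel_measurable_induct)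
  case (cong f g)
  have "(\<integral>\<^sup>+x. f (x, c) \<partial>count_space (T c)) = (\<integral>\<^sup>+x. g (x, c) \<partial>count_space (T c))"
    if "c \<in> space N" for c
    using that by (intro nn_integral_cong cong) (auto simp: space_pair_measure)
  then show ?case
    using cong(4) by (simp cong: measurable_cong)
next
  case (set A)
  show ?case
    by (subst nn_integral_count_space_ball_SUP)
       (intro borel_measurable_SUP measurable_sum_indicator[OF T set], auto)
next
  case (mult f c)
  then show ?case by (simp add: nn_integral_cmult)
next
  case (add f g)
  then show ?case by (simp add: nn_integral_add)
next
  case (seq F)
  have "(\<integral>\<^sup>+x. (SUP i. F i) (x, c) \<partial>count_space (T c))
      = (SUP i. \<integral>\<^sup>+x. F i (x, c) \<partial>count_space (T c))" for c
    unfolding SUP_apply using seq(3)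
    by (intro nn_integral_monotone_convergence_SUP) (auto simp: incseq_def le_fun_def)
  then show ?case
    using seq by simp
qed

section \<open>Exponentials and planar integrals\<close>

text \<open>The function exp(-t), extended by 0 at infinity. The extension is continuous and
  multiplicative, so the Laplace functional can be stated for sums that may diverge.\<close>

definition exp_neg :: "ennreal \<Rightarrow> ennreal" where
  "exp_neg t = (if t = \<infinity> then 0 else ennreal (exp (- enn2real t)))"

lemma exp_neg_ennreal: "0 \<le> r \<Longrightarrow> exp_neg (ennreal r) = ennreal (exp (- r))"
  by (simp add: exp_neg_def)

lemma exp_neg_top [simp]: "exp_neg \<infinity> = 0" "exp_neg \<top> = 0"
  by (simp_all add: exp_neg_def)

lemma exp_neg_0 [simp]: "exp_neg 0 = 1"
  by (simp add: exp_neg_def)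

lemma exp_neg_le_1: "exp_neg t \<le> 1"
  by (simp add: exp_neg_def ennreal_le_1)

lemma exp_neg_add: "exp_neg (s + t) = exp_neg s * exp_neg t"
  by (cases s; cases t)
     (simp_all add: exp_neg_ennreal ennreal_plus[symmetric] ennreal_mult[symmetric] exp_add[symmetric]
        algebra_simps del: ennreal_plus)

lemma exp_neg_sum: "exp_neg (\<Sum>i\<in>I. f i) = (\<Prod>i\<in>I. exp_neg (f i))"
  by (induction I rule: infinite_finite_induct) (simp_all add: exp_neg_add)

lemma exp_neg_mult_of_nat: "exp_neg (t * of_nat n) = exp_neg t ^ n"
  by (induction n) (simp_all add: exp_neg_add distrib_left)

lemma exp_neg_antimono: "s \<le> t \<Longrightarrow> exp_neg t \<le> exp_neg s"
  by (cases s; cases t) (auto simp: exp_neg_ennreal top_unique)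

lemma tendsto_exp_neg:
  assumes "(f \<longlongrightarrow> t) F"
  shows "((\<lambda>x. exp_neg (f x)) \<longlongrightarrow> exp_neg t) F"
proof (cases t)
  case (real r)
  then have "eventually (\<lambda>x. f x < ennreal (r + 1)) F"
    using assms by (intro order_tendstoD(2)) (auto simp: ennreal_less_iff)
  then have "eventually (\<lambda>x. ennreal (exp (- enn2real (f x))) = exp_neg (f x)) F"
    by eventually_elim (auto simp: exp_neg_def)
  moreover have "((\<lambda>x. ennreal (exp (- enn2real (f x)))) \<longlongrightarrow> ennreal (exp (- r))) F"
    using assms real by (intro tendsto_intros tendsto_enn2real) auto
  ultimately show ?thesis
    using real by (auto simp: exp_neg_ennreal intro: Lim_transform_eventually)
next
  case top
  have "((\<lambda>x. exp_neg (f x)) \<longlongrightarrow> 0) F"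
  proof (rule order_tendstoI)
    fix a :: ennreal assume "0 < a"
    then obtain e where e: "0 < e" "ennreal e < a"
      by (metis ennreal_zero_less_top dense ennreal_cases ennreal_less_zero_iff less_top_ennreal not_less_iff_gr_or_eq order_less_trans)
    \<comment> \<open>Above the level \<open>- ln e\<close> the exponential is at most
      \<open>e\<close>; the level is cut off at 0 because it has to be a nonnegative number.\<close>
    have "eventually (\<lambda>x. ennreal (max 0 (- ln e)) < f x) F"
      using assms top by (intro order_tendstoD(1)) auto
    then show "eventually (\<lambda>x. exp_neg (f x) < a) F"
    proof eventually_elim
      case (elim x)
      then have "exp_neg (f x) \<le> exp_neg (ennreal (max 0 (- ln e)))"
        by (intro exp_neg_antimono) simp
      also have "\<dots> \<le> ennreal e"
        using e by (auto simp: exp_neg_ennreal max_def intro!: ennreal_leI)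
      finally show ?case using e(2) by simp
    qed
  qed simp
  then show ?thesis using top by simp
qed

lemma measurable_exp_neg [measurable]: "exp_neg \<in> borel_measurable borel"
  by (intro borel_measurable_continuous_onI)
     (auto simp: continuous_on_def intro: tendsto_exp_neg tendsto_ident_at)

lemma exp_neg_SUP_LIMSEQ:
  assumes "incseq t"
  shows "(\<lambda>n. exp_neg (t n)) \<longlonglongrightarrow> exp_neg (SUP n. t n)"
  by (intro tendsto_exp_neg LIMSEQ_SUP assms)

text \<open>The tail of a unit exponential variable. Writing \<open>exp_neg t\<close> as an integral
  over \<open>v\<close> lets a planar integral of exponentials be taken level by level after
  exchanging the integrals.\<close>

lemma nn_integral_exp_neg_tail:
  "(\<integral>\<^sup>+v. ennreal (exp (- v)) * indicator {v. 0 \<le> v \<and> t \<le> ennreal v} v \<partial>lborel) = exp_neg t"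
proof (cases t)
  case (real r)
  have lim: "((\<lambda>x::real. - exp (- x)) \<longlongrightarrow> 0) at_top"
    using tendsto_minus[OF filterlim_compose[OF exp_at_bot filterlim_uminus_at_bot_at_top]] by simp
  have "{v. 0 \<le> v \<and> t \<le> ennreal v} = {r..}"
    using real by (auto simp: ennreal_le_iff)
  moreover have "(\<integral>\<^sup>+v. ennreal (exp (- v)) * indicator {r..} v \<partial>lborel) = 0 - (- exp (- r))"
    by (rule nn_integral_FTC_atLeast[OF _ _ _ lim]) (auto intro!: derivative_eq_intros)
  ultimately show ?thesis
    using real by (simp add: exp_neg_ennreal)
qed (simp add: top_unique)

text \<open>The complementary event of the exponential tail: the two pieces add up to the total mass
  1, and \<open>exp_neg t\<close> is finite and can be cancelled.\<close>

lemma nn_integral_exp_neg_head: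
  "(\<integral>\<^sup>+v. ennreal (exp (- v)) * indicator {v. 0 \<le> v \<and> ennreal v < t} v \<partial>lborel) = 1 - exp_neg t"
    (is "?A = _")
proof -
  have "?A + exp_neg t = (\<integral>\<^sup>+v. ennreal (exp (- v)) * indicator {v. 0 \<le> v \<and> 0 \<le> ennreal v} v \<partial>lborel)"
    unfolding nn_integral_exp_neg_tail[of t, symmetric]
    by (subst nn_integral_add[symmetric]) (auto intro!: nn_integral_cong simp: indicator_def)
  then have "?A + exp_neg t = 1"
    unfolding nn_integral_exp_neg_tail by simp
  then show ?thesis
    by (metis ennreal_add_diff_cancel_right exp_neg_le_1 ennreal_one_neq_top neq_top_trans)
qed

section \<open>Planar integrals of exponentials of powers of the norm\<close>

lemma emeasure_ball_point: "0 \<le> r \<Longrightarrow> emeasure lborel (ball (c::point) r) = ennreal (pi * r\<^sup>2)"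
  by (simp add: emeasure_ball unit_ball_vol_2)

lemma emeasure_cball_point: "0 \<le> r \<Longrightarrow> emeasure lborel (cball (c::point) r) = ennreal (pi * r\<^sup>2)"
  by (simp add: emeasure_cball unit_ball_vol_2)

lemma Gamma_nn_integral:
  assumes "0 < s"
  shows "(\<integral>\<^sup>+v. ennreal (exp (- v)) * indicator {0<..} v * ennreal (v powr (s - 1)) \<partial>lborel)
    = ennreal (Gamma s)"
  unfolding Gamma_conv_nn_integral_real[OF assms]
  using AE_lborel_singleton[of "0::real"]
  by (intro nn_integral_cong_AE, eventually_elim)
     (auto simp: indicator_def ennreal_mult[symmetric] exp_minus field_simps)

lemma powr_less_powr_iff:
  fixes x y a :: real
  assumes "0 < a" "0 \<le> x" "0 \<le> y"
  shows "x powr a < y powr a \<longleftrightarrow> x < y"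
  using assms powr_less_mono2[of a x y] powr_mono2[of a y x] by linarith

text \<open>Both planar integrals below are layer-cake integrals over the level sets, which are discs.\<close>

lemma nn_integral_exp_neg_powr_norm:
  fixes T p :: real
  assumes "0 < T" "0 < p"
  shows "(\<integral>\<^sup>+(x::point). exp_neg (ennreal (T * norm x powr p)) \<partial>lborel)
    = ennreal (pi * T powr (- (2 / p)) * Gamma (1 + 2 / p))"
proof -
  have "(\<integral>\<^sup>+(x::point). exp_neg (ennreal (T * norm x powr p)) \<partial>lborel)
      = (\<integral>\<^sup>+(x::point). \<integral>\<^sup>+v. ennreal (exp (- v)) *
          indicator {v. 0 \<le> v \<and> ennreal (T * norm x powr p) \<le> ennreal v} v \<partial>lborel \<partial>lborel)"
    unfolding nn_integral_exp_neg_tail ..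
  also have "\<dots> = (\<integral>\<^sup>+v. \<integral>\<^sup>+(x::point). ennreal (exp (- v)) *
          indicator {v. 0 \<le> v \<and> ennreal (T * norm x powr p) \<le> ennreal v} v \<partial>lborel \<partial>lborel)"
    by (rule lborel_pair.Fubini') measurable
  also have "\<dots> = (\<integral>\<^sup>+v. ennreal (pi * T powr (- (2 / p))) *
      (ennreal (exp (- v)) * indicator {0<..} v * ennreal (v powr ((1 + 2 / p) - 1))) \<partial>lborel)"
  \<comment> \<open>The value \<open>v = 0\<close> is discarded as a null set, so the remaining
    level sets are discs of positive radius; a negative \<open>v\<close> contributes 0 on both
    sides.\<close>
  proof (intro nn_integral_cong_AE, use AE_lborel_singleton[of "0::real"] in eventually_elim)
    case (elim v)
    show ?case
    proof (cases "0 < v")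
      case True
      have "T * norm x powr p \<le> v \<longleftrightarrow> x \<in> cball 0 ((v / T) powr (1 / p))" for x :: point
      proof -
        have "T * norm x powr p \<le> v \<longleftrightarrow> norm x powr p \<le> ((v / T) powr (1 / p)) powr p"
          using assms True by (simp add: powr_powr field_simps)
        also have "\<dots> \<longleftrightarrow> norm x \<le> (v / T) powr (1 / p)"
          using assms powr_less_powr_iff[of p "(v / T) powr (1 / p)" "norm x"] by (simp add: not_less[symmetric])
        finally show ?thesis by simp
      qed
      then have "(\<integral>\<^sup>+(x::point). ennreal (exp (- v)) *
          indicator {v. 0 \<le> v \<and> ennreal (T * norm x powr p) \<le> ennreal v} v \<partial>lborel)
        = (\<integral>\<^sup>+(x::point). ennreal (exp (- v)) * indicator (cball 0 ((v / T) powr (1 / p))) x \<partial>lborel)"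
        using True assms by (intro nn_integral_cong) (auto simp: indicator_def ennreal_le_iff)
      also have "\<dots> = ennreal (exp (- v)) * ennreal (pi * ((v / T) powr (1 / p))\<^sup>2)"
        by (subst nn_integral_cmult_indicator) (auto simp: emeasure_cball_point)
      also have "((v / T) powr (1 / p))\<^sup>2 = T powr (- (2 / p)) * v powr (2 / p)"
        using True assms
        by (simp add: powr_powr powr_divide powr_minus field_simps flip: powr_realpow powr_numeral)
      finally show ?thesis
        using True by (simp add: ennreal_mult[symmetric] mult_ac)
    next
      case False
      then show ?thesis using elim by simp
    qed
  qed
  also have "\<dots> = ennreal (pi * T powr (- (2 / p)) * Gamma (1 + 2 / p))"
    using assms
    by (subst nn_integral_cmult, measurable, subst Gamma_nn_integral)
       (simp_all add: ennreal_mult add_pos_pos)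
  finally show ?thesis .
qed

lemma measurable_power_law_gain [measurable]: "power_law_gain b \<in> borel_measurable borel"
  unfolding power_law_gain_def by measurable

lemma nn_integral_one_minus_exp_neg_gain:
  assumes "0 < s" "1 < b"
  shows "(\<integral>\<^sup>+(x::point). 1 - exp_neg (ennreal s * power_law_gain b (norm x)) \<partial>lborel)
    = ennreal (pi * s powr (1 / b) * Gamma (1 - 1 / b))"
proof -
  have "(\<integral>\<^sup>+(x::point). 1 - exp_neg (ennreal s * power_law_gain b (norm x)) \<partial>lborel)
      = (\<integral>\<^sup>+(x::point). \<integral>\<^sup>+v. ennreal (exp (- v)) *
          indicator {v. 0 \<le> v \<and> ennreal v < ennreal s * power_law_gain b (norm x)} v \<partial>lborel \<partial>lborel)"
    unfolding nn_integral_exp_neg_head ..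
  also have "\<dots> = (\<integral>\<^sup>+v. \<integral>\<^sup>+(x::point). ennreal (exp (- v)) *
          indicator {v. 0 \<le> v \<and> ennreal v < ennreal s * power_law_gain b (norm x)} v \<partial>lborel \<partial>lborel)"
    by (rule lborel_pair.Fubini') measurable
  also have "\<dots> = (\<integral>\<^sup>+v. ennreal (pi * s powr (1 / b)) *
      (ennreal (exp (- v)) * indicator {0<..} v * ennreal (v powr ((1 - 1 / b) - 1))) \<partial>lborel)"
  proof (intro nn_integral_cong_AE, use AE_lborel_singleton[of "0::real"] in eventually_elim)
    case (elim v)
    show ?case
    proof (cases "0 < v")
      case True
      have "ennreal v < ennreal s * power_law_gain b (norm x) \<longleftrightarrow> x \<in> ball 0 ((s / v) powr (1 / (2 * b)))"
        for x :: point
      \<comment> \<open>At the origin the gain is infinite, so the left side holds there, and the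
        ball has positive radius.\<close>
      proof (cases "x = 0")
        case False
        then have "ennreal v < ennreal s * power_law_gain b (norm x) \<longleftrightarrow> v < s * (1 / norm x powr (2 * b))"
          using assms True
          by (simp add: power_law_gain_def ennreal_1[symmetric] divide_ennreal ennreal_mult[symmetric]
              ennreal_less_iff del: ennreal_1)
        also have "\<dots> \<longleftrightarrow> norm x powr (2 * b) < ((s / v) powr (1 / (2 * b))) powr (2 * b)"
          using assms True False by (simp add: powr_powr field_simps)
        also have "\<dots> \<longleftrightarrow> norm x < (s / v) powr (1 / (2 * b))"
          using assms by (intro powr_less_powr_iff) auto
        finally show ?thesis by simp
      qed (use assms True in \<open>simp add: power_law_gain_def ennreal_mult_top\<close>)
      then have "(\<integral>\<^sup>+(x::point). ennreal (exp (- v)) *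
          indicator {v. 0 \<le> v \<and> ennreal v < ennreal s * power_law_gain b (norm x)} v \<partial>lborel)
        = (\<integral>\<^sup>+(x::point). ennreal (exp (- v)) * indicator (ball 0 ((s / v) powr (1 / (2 * b)))) x \<partial>lborel)"
        using True by (intro nn_integral_cong) (auto simp: indicator_def)
      also have "\<dots> = ennreal (exp (- v)) * ennreal (pi * ((s / v) powr (1 / (2 * b)))\<^sup>2)"
        by (subst nn_integral_cmult_indicator) (auto simp: emeasure_ball_point)
      also have "((s / v) powr (1 / (2 * b)))\<^sup>2 = s powr (1 / b) * v powr (- (1 / b))"
        using True assms
        by (simp add: powr_powr powr_divide powr_minus field_simps flip: powr_realpow powr_numeral)
      finally show ?thesis
        using True by (simp add: ennreal_mult[symmetric] mult_ac)
    next
      case False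
      then show ?thesis using elim by simp
    qed
  qed
  \<comment> \<open>This is where \<open>b > 1\<close> enters: the Gamma integral with parameter
    \<open>1 - 1 / b\<close> converges only if the parameter is positive.\<close>
  also have "\<dots> = ennreal (pi * s powr (1 / b) * Gamma (1 - 1 / b))"
    using assms
    by (subst nn_integral_cmult, measurable, subst Gamma_nn_integral)
       (simp_all add: ennreal_mult)
  finally show ?thesis .
qed

section \<open>Poisson point processes\<close>

lemma nn_integral_count_space_steps:
  fixes B :: "nat \<Rightarrow> point set" and c :: "nat \<Rightarrow> ennreal"
  assumes "locally_finite S" "\<And>i. i < k \<Longrightarrow> bounded (B i)"
  shows "(\<integral>\<^sup>+x. (\<Sum>i<k. c i * indicator (B i) x) \<partial>count_space S)
    = (\<Sum>i<k. c i * of_nat (card (S \<inter> B i)))"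
proof -
  have "(\<integral>\<^sup>+x. (\<Sum>i<k. c i * indicator (B i) x) \<partial>count_space S)
      = (\<Sum>i<k. \<integral>\<^sup>+x. c i * indicator (B i) x \<partial>count_space S)"
    by (rule nn_integral_sum) simp
  also have "\<dots> = (\<Sum>i<k. c i * of_nat (card (S \<inter> B i)))"
    using assms by (intro sum.cong refl) (simp add: nn_integral_count_space_bounded mult.commute)
  finally show ?thesis .
qed

text \<open>By disjointness at most one term of the sum is nonzero, and \<open>f 0 = 0\<close> takes
  care of the points outside all the sets. It is applied to the map from \<open>t\<close> to
  \<open>1 - exp_neg t\<close>.\<close>

lemma disjoint_steps_comp:
  fixes f :: "ennreal \<Rightarrow> ennreal" and B :: "nat \<Rightarrow> 'a set"
  assumes "disjoint_family_on B {..<k}" "f 0 = 0"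
  shows "f (\<Sum>i<k. c i * indicator (B i) x) = (\<Sum>i<k. f (c i) * indicator (B i) x)"
proof (cases "\<exists>j<k. x \<in> B j")
  case True
  then obtain j where j: "j < k" "x \<in> B j" by blast
  have "x \<notin> B i" if "i < k" "i \<noteq> j" for i
    using assms(1) j that unfolding disjoint_family_on_def by auto
  then have "(\<Sum>i<k. g i * indicator (B i) x) = g j" for g :: "nat \<Rightarrow> ennreal"
    using j by (subst sum.remove[of _ j]) (auto intro!: sum.neutral)
  then show ?thesis by simp
next
  case False
  then show ?thesis using assms(2) by (simp add: indicator_def)
qed

text \<open>The sets are the level sets of the nonzero values. They are numbered below
  \<open>k\<close> because the independence clause of a Poisson process speaks of finite families
  indexed this way.\<close>

lemma simple_function_bounded_steps:
  fixes h :: "point \<Rightarrow> ennreal"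
  assumes "simple_function borel h" "bounded {x. h x \<noteq> 0}"
  obtains k and B :: "nat \<Rightarrow> point set" and c :: "nat \<Rightarrow> ennreal"
  where "\<forall>i<k. B i \<in> sets borel \<and> bounded (B i)"
    "disjoint_family_on B {..<k}" "h = (\<lambda>x. \<Sum>i<k. c i * indicator (B i) x)"
proof -
  \<comment> \<open>The value 0 is left out: its level set is unbounded, while all the others lie in
    the bounded support.\<close>
  define V where "V = range h - {0}"
  have "finite V"
    using assms(1) by (auto simp: V_def simple_function_def)
  then obtain c where c: "bij_betw c {..<card V} V"
    using ex_bij_betw_nat_finite by (auto simp: atLeast0LessThan)
  define B where "B i = h -` {c i}" for i
  have cV: "c i \<in> V" if "i < card V" for i
    using c that by (auto simp: bij_betw_def)
  show ?thesis
  proof (rule that)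
    have "B i \<in> sets borel" if "i < card V" for i
      using simple_functionD(2)[OF assms(1), of "{c i}"] by (simp add: B_def)
    moreover have "bounded (B i)" if "i < card V" for i
      using cV[OF that] by (intro bounded_subset[OF assms(2)]) (auto simp: B_def V_def)
    ultimately show "\<forall>i<card V. B i \<in> sets borel \<and> bounded (B i)" by blast
    show disj: "disjoint_family_on B {..<card V}"
      using c by (auto simp: disjoint_family_on_def B_def bij_betw_def inj_on_def)
    have "h x = (\<Sum>i<card V. c i * indicator (B i) x)" for x
    proof (cases "h x = 0")
      case True
      then have "x \<notin> B i" if "i < card V" for i
        using cV[OF that] by (auto simp: B_def V_def)
      then show ?thesis using True by simp
    next
      case False
      then have "h x \<in> c ` {..<card V}"
        using bij_betw_imp_surj_on[OF c] by (simp add: V_def)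
      then obtain j where j: "j < card V" "c j = h x" by auto
      have "x \<notin> B i" if "i < card V" "i \<noteq> j" for i
        using c j that by (auto simp: B_def bij_betw_def inj_on_def)
      then have "(\<Sum>i<card V. c i * indicator (B i) x) = c j"
        using j by (subst sum.remove[of _ j]) (auto simp: B_def intro!: sum.neutral)
      then show ?thesis using j by simp
    qed
    then show "h = (\<lambda>x. \<Sum>i<card V. c i * indicator (B i) x)" by auto
  qed
qed

text \<open>Each simple approximation is cut off outside the ball of radius \<open>n\<close>, since
  the definition of a Poisson process only prescribes counts in bounded sets.\<close>

lemma borel_measurable_bounded_simple_sequence:
  fixes h :: "point \<Rightarrow> ennreal"
  assumes "h \<in> borel_measurable borel"
  obtains f where "\<And>n. simple_function borel (f n)" "\<And>n. bounded {x. f n x \<noteq> 0}"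
    "incseq f" "\<And>x. (SUP n. f n x) = h x"
proof -
  obtain g where g: "\<And>n. simple_function borel (g n)" "incseq g" "\<And>n x. g n x < top"
    "\<And>x. (SUP n. g n x) = h x"
    using borel_measurable_implies_simple_function_sequence'[OF assms] by metis
  define f where "f n x = g n x * indicator (ball 0 (real n)) x" for n x
  show ?thesis
  proof (rule that)
    show "simple_function borel (f n)" for n
      unfolding f_def by (intro simple_function_mult g simple_function_indicator) auto
    show "bounded {x. f n x \<noteq> 0}" for n
      by (rule bounded_subset[of "ball 0 (real n)"]) (auto simp: f_def indicator_def)
    show inc: "incseq f"
      using g(2) by (fastforce simp: incseq_def le_fun_def f_def indicator_def)
    show "(SUP n. f n x) = h x" for x
    proof (rule antisym)
      show "(SUP n. f n x) \<le> h x"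
        unfolding g(4)[symmetric] by (intro SUP_mono) (auto simp: f_def indicator_def)
      obtain m :: nat where "norm x < real m"
        using reals_Archimedean2 by blast
      \<comment> \<open>From the index \<open>m\<close> on, the ball contains \<open>x\<close>; the
        maximum secures this without losing the approximation \<open>g n x\<close>.\<close>
      then have "g n x \<le> f (max n m) x" for n
        using g(2) by (auto simp: f_def incseq_def le_fun_def indicator_def)
      then show "h x \<le> (SUP n. f n x)"
        unfolding g(4)[symmetric] by (intro SUP_mono) auto
    qed
  qed
qed

section \<open>Expectations of functions of Poisson counts\<close>

lemma nn_integral_nat_valued:
  fixes X :: "'a \<Rightarrow> nat" and F :: "nat \<Rightarrow> ennreal"
  assumes [measurable]: "X \<in> M \<rightarrow>\<^sub>M count_space UNIV"
  shows "(\<integral>\<^sup>+\<omega>. F (X \<omega>) \<partial>M) = (\<Sum>n. F n * emeasure M {\<omega> \<in> space M. X \<omega> = n})"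
proof -
  have "(\<integral>\<^sup>+\<omega>. F (X \<omega>) \<partial>M) = (\<integral>\<^sup>+\<omega>. (\<Sum>n. F n * indicator {\<omega> \<in> space M. X \<omega> = n} \<omega>) \<partial>M)"
  proof (rule nn_integral_cong)
    fix \<omega> assume "\<omega> \<in> space M"
    then show "F (X \<omega>) = (\<Sum>n. F n * indicator {\<omega> \<in> space M. X \<omega> = n} \<omega>)"
      by (subst suminf_finite[of "{X \<omega>}"]) (auto simp: indicator_def)
  qed
  also have "\<dots> = (\<Sum>n. \<integral>\<^sup>+\<omega>. F n * indicator {\<omega> \<in> space M. X \<omega> = n} \<omega> \<partial>M)"
    by (rule nn_integral_suminf) measurable
  also have "\<dots> = (\<Sum>n. F n * emeasure M {\<omega> \<in> space M. X \<omega> = n})"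
    by (intro suminf_cong nn_integral_cmult_indicator) measurable
  finally show ?thesis .
qed

lemma suminf_poisson_pgf:
  fixes r z :: real
  assumes "0 \<le> r" "0 \<le> z"
  shows "(\<Sum>n. ennreal z ^ n * ennreal (r ^ n / fact n * exp (- r))) = ennreal (exp (- (r * (1 - z))))"
proof -
  have "(\<lambda>n. (z * r) ^ n /\<^sub>R fact n * exp (- r)) sums (exp (z * r) * exp (- r))"
    by (intro sums_mult2 exp_converges)
  then have "(\<lambda>n. z ^ n * (r ^ n / fact n * exp (- r))) sums (exp (z * r - r))"
    by (simp add: power_mult_distrib field_simps exp_diff exp_minus)
  then have "(\<Sum>n. ennreal (z ^ n * (r ^ n / fact n * exp (- r)))) = ennreal (exp (z * r - r))"
    using assms by (intro suminf_ennreal_eq) auto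
  then show ?thesis
    using assms
    by (simp add: ennreal_mult[symmetric] ennreal_power algebra_simps del: times_divide_eq_left)
qed

lemma suminf_poisson_mean:
  fixes r :: real
  assumes "0 \<le> r"
  shows "(\<Sum>n. of_nat n * ennreal (r ^ n / fact n * exp (- r))) = ennreal r"
proof -
  have "(\<lambda>n. r ^ n /\<^sub>R fact n * (r * exp (- r))) sums (exp r * (r * exp (- r)))"
    by (intro sums_mult2 exp_converges)
  then have "(\<lambda>n. real (Suc n) * (r ^ Suc n / fact (Suc n) * exp (- r))) sums r"
    by (simp add: fact_Suc exp_minus divide_simps mult_ac del: of_nat_Suc)
  \<comment> \<open>The factor \<open>Suc n\<close> has cancelled against the factorial in the
    shifted series; the term at 0 vanishes, so shifting back leaves the sum unchanged.\<close>
  then have "(\<lambda>n. real n * (r ^ n / fact n * exp (- r))) sums r"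
    by (subst (asm) sums_Suc_iff) simp
  then have "(\<Sum>n. ennreal (real n * (r ^ n / fact n * exp (- r)))) = ennreal r"
    using assms by (intro suminf_ennreal_eq) auto
  then show ?thesis
    using assms
    by (simp add: ennreal_mult[symmetric] ennreal_of_nat_eq_real_of_nat del: times_divide_eq_left)
qed

section \<open>Campbell's formula and the Laplace functional\<close>

context prob_space
begin

lemma poisson_point_process_measurable:
  "poisson_point_process lam \<Phi> \<Longrightarrow> \<Phi> \<in> M \<rightarrow>\<^sub>M configurations"
  unfolding poisson_point_process_def by blast

lemma poisson_point_process_locally_finite:
  "poisson_point_process lam \<Phi> \<Longrightarrow> \<omega> \<in> space M \<Longrightarrow> locally_finite (\<Phi> \<omega>)"
  using measurable_space[OF poisson_point_process_measurable] by fastforce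

lemma measurable_poisson_card:
  assumes "poisson_point_process lam \<Phi>" "B \<in> sets borel" "bounded B"
  shows "(\<lambda>\<omega>. card (\<Phi> \<omega> \<inter> B)) \<in> M \<rightarrow>\<^sub>M count_space UNIV"
  using measurable_compose[OF poisson_point_process_measurable measurable_card_Int] assms by blast

lemma measurable_poisson_sum:
  assumes "poisson_point_process lam \<Phi>" and [measurable]: "h \<in> borel_measurable borel"
  shows "(\<lambda>\<omega>. \<integral>\<^sup>+x. h x \<partial>count_space (\<Phi> \<omega>)) \<in> borel_measurable M"
  using measurable_sum_configuration[OF poisson_point_process_measurable[OF assms(1)], of "\<lambda>(x, \<omega>). h x"]
  by simp

lemma emeasure_poisson_card:
  assumes "poisson_point_process lam \<Phi>" "B \<in> sets borel" "bounded B"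
  shows "emeasure M {\<omega> \<in> space M. card (\<Phi> \<omega> \<inter> B) = n}
    = ennreal ((lam * measure lborel B) ^ n / fact n * exp (- (lam * measure lborel B)))"
  using assms unfolding poisson_point_process_def emeasure_eq_measure by simp

text \<open>For step functions with bounded support this is the mean of the Poisson counts and
  linearity. Monotone convergence extends both sides to nonnegative Borel functions, infinite values
  included.\<close>

lemma campbell:
  assumes ppp: "poisson_point_process lam \<Phi>" and "0 \<le> lam" and "h \<in> borel_measurable borel"
  shows "(\<integral>\<^sup>+\<omega>. \<integral>\<^sup>+x. h x \<partial>count_space (\<Phi> \<omega>) \<partial>M) = ennreal lam * (\<integral>\<^sup>+x. h x \<partial>lborel)"
proof -
  obtain f where f: "\<And>n. simple_function borel (f n)" "\<And>n. bounded {x. f n x \<noteq> 0}"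
    "incseq f" "\<And>x. (SUP n. f n x) = h x"
    using borel_measurable_bounded_simple_sequence[OF assms(3)] by metis
  note f_meas [measurable] = borel_measurable_simple_function[OF f(1)]
  have step: "(\<integral>\<^sup>+\<omega>. \<integral>\<^sup>+x. f n x \<partial>count_space (\<Phi> \<omega>) \<partial>M) = ennreal lam * (\<integral>\<^sup>+x. f n x \<partial>lborel)" for n
  proof -
    obtain k :: nat and B c where "\<forall>i<k. B i \<in> sets borel \<and> bounded (B i)"
      and "disjoint_family_on B {..<k}"
      and fn: "f n = (\<lambda>x. \<Sum>i<k. c i * indicator (B i) x)"
      using simple_function_bounded_steps[OF f(1,2)] by blast
    from this(1) have B: "\<And>i. i < k \<Longrightarrow> B i \<in> sets borel" "\<And>i. i < k \<Longrightarrow> bounded (B i)"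
      by blast+
    have card_B: "(\<integral>\<^sup>+\<omega>. of_nat (card (\<Phi> \<omega> \<inter> B i)) \<partial>M) = ennreal lam * emeasure lborel (B i)"
      if i: "i < k" for i
    proof -
      have "(\<integral>\<^sup>+\<omega>. of_nat (card (\<Phi> \<omega> \<inter> B i)) \<partial>M) = ennreal (lam * measure lborel (B i))"
        using B[OF i] \<open>0 \<le> lam\<close>
        by (subst nn_integral_nat_valued)
           (auto simp: measurable_poisson_card[OF ppp] emeasure_poisson_card[OF ppp] suminf_poisson_mean
             simp del: times_divide_eq_left)
      then show ?thesis
        using emeasure_bounded_finite[OF B(2)[OF i]] \<open>0 \<le> lam\<close>
        by (simp add: ennreal_mult emeasure_eq_ennreal_measure)
    qed
    have "(\<integral>\<^sup>+\<omega>. \<integral>\<^sup>+x. f n x \<partial>count_space (\<Phi> \<omega>) \<partial>M)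
        = (\<integral>\<^sup>+\<omega>. (\<Sum>i<k. c i * of_nat (card (\<Phi> \<omega> \<inter> B i))) \<partial>M)"
      unfolding fn using B poisson_point_process_locally_finite[OF ppp]
      by (intro nn_integral_cong nn_integral_count_space_steps) auto
    also have "\<dots> = (\<Sum>i<k. c i * (ennreal lam * emeasure lborel (B i)))"
      using measurable_poisson_card[OF ppp B]
      by (subst nn_integral_sum) (auto simp: nn_integral_cmult card_B intro!: sum.cong)
    also have "\<dots> = ennreal lam * (\<integral>\<^sup>+x. f n x \<partial>lborel)"
      unfolding fn using B
      by (subst nn_integral_sum) (auto simp: nn_integral_cmult_indicator sum_distrib_left mult_ac intro!: sum.cong)
    finally show ?thesis .
  qed
  have sum_SUP: "(\<integral>\<^sup>+x. h x \<partial>N) = (SUP n. \<integral>\<^sup>+x. f n x \<partial>N)"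
    if "\<And>n. f n \<in> borel_measurable N" for N
    unfolding f(4)[symmetric] using f(3) that by (rule nn_integral_monotone_convergence_SUP)
  have "(\<integral>\<^sup>+\<omega>. \<integral>\<^sup>+x. h x \<partial>count_space (\<Phi> \<omega>) \<partial>M)
      = (\<integral>\<^sup>+\<omega>. (SUP n. \<integral>\<^sup>+x. f n x \<partial>count_space (\<Phi> \<omega>)) \<partial>M)"
    by (simp add: sum_SUP)
  also have "\<dots> = (SUP n. \<integral>\<^sup>+\<omega>. \<integral>\<^sup>+x. f n x \<partial>count_space (\<Phi> \<omega>) \<partial>M)"
    using f(3) by (intro nn_integral_monotone_convergence_SUP measurable_poisson_sum[OF ppp] f_meas)
      (auto simp: incseq_def le_fun_def intro!: nn_integral_mono)
  also have "\<dots> = ennreal lam * (\<integral>\<^sup>+x. h x \<partial>lborel)"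
    unfolding step by (subst sum_SUP) (auto simp: SUP_mult_left_ennreal)
  finally show ?thesis .
qed

text \<open>For a step function with disjoint bounded sets, the exponential of the sum is a product
  of powers indexed by the counts. Independence factorises its expectation, and the Poisson
  generating function evaluates every factor. The general case follows by approximation from below
  and continuity of \<open>exp_neg\<close>.\<close>

lemma laplace_functional:
  assumes ppp: "poisson_point_process lam \<Phi>" and "0 \<le> lam" and h: "h \<in> borel_measurable borel"
  shows "(\<integral>\<^sup>+\<omega>. exp_neg (\<integral>\<^sup>+x. h x \<partial>count_space (\<Phi> \<omega>)) \<partial>M)
    = exp_neg (ennreal lam * (\<integral>\<^sup>+x. 1 - exp_neg (h x) \<partial>lborel))"
proof -
  obtain f where f: "\<And>n. simple_function borel (f n)" "\<And>n. bounded {x. f n x \<noteq> 0}"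
    "incseq f" "\<And>x. (SUP n. f n x) = h x"
    using borel_measurable_bounded_simple_sequence[OF h] by metis
  note f_meas [measurable] = borel_measurable_simple_function[OF f(1)]
  have step: "(\<integral>\<^sup>+\<omega>. exp_neg (\<integral>\<^sup>+x. f n x \<partial>count_space (\<Phi> \<omega>)) \<partial>M)
      = exp_neg (ennreal lam * (\<integral>\<^sup>+x. 1 - exp_neg (f n x) \<partial>lborel))" for n
  proof -
    obtain k :: nat and B c where "\<forall>i<k. B i \<in> sets borel \<and> bounded (B i)"
      and disj: "disjoint_family_on B {..<k}"
      and fn: "f n = (\<lambda>x. \<Sum>i<k. c i * indicator (B i) x)"
      using simple_function_bounded_steps[OF f(1,2)] by blast
    from this(1) have B: "\<And>i. i < k \<Longrightarrow> B i \<in> sets borel" "\<And>i. i < k \<Longrightarrow> bounded (B i)"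
      by blast+
    have indep: "indep_vars (\<lambda>_. count_space UNIV) (\<lambda>i \<omega>. card (\<Phi> \<omega> \<inter> B i)) {..<k}"
      using ppp B disj unfolding poisson_point_process_def by blast
    \<comment> \<open>The generating function is taken at \<open>z = exp_neg (c i)\<close>. An
      infinite \<open>c i\<close> gives \<open>z = 0\<close>, and with \<open>0 ^ 0 = 1\<close> the
      formula becomes the probability that \<open>B i\<close> contains no point.\<close>
    have pgf: "(\<integral>\<^sup>+\<omega>. exp_neg (c i) ^ card (\<Phi> \<omega> \<inter> B i) \<partial>M)
        = exp_neg (ennreal lam * ((1 - exp_neg (c i)) * emeasure lborel (B i)))" if i: "i < k" for i
    proof -
      obtain z where z: "exp_neg (c i) = ennreal z" "0 \<le> z" "z \<le> 1"
        using exp_neg_le_1[of "c i"] by (cases "exp_neg (c i)") (auto simp: top_unique)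
      have "(\<integral>\<^sup>+\<omega>. exp_neg (c i) ^ card (\<Phi> \<omega> \<inter> B i) \<partial>M)
          = ennreal (exp (- (lam * measure lborel (B i) * (1 - z))))"
        using B[OF i] \<open>0 \<le> lam\<close> z
        by (subst nn_integral_nat_valued)
           (auto simp: measurable_poisson_card[OF ppp] emeasure_poisson_card[OF ppp] suminf_poisson_pgf
             simp del: times_divide_eq_left)
      also have "\<dots> = exp_neg (ennreal (lam * measure lborel (B i) * (1 - z)))"
        using z \<open>0 \<le> lam\<close> by (simp add: exp_neg_ennreal)
      also have "ennreal (lam * measure lborel (B i) * (1 - z))
          = ennreal lam * ((1 - exp_neg (c i)) * emeasure lborel (B i))"
        using emeasure_bounded_finite[OF B(2)[OF i]] \<open>0 \<le> lam\<close> z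
        by (simp add: ennreal_mult emeasure_eq_ennreal_measure ennreal_minus[symmetric] mult_ac
            flip: ennreal_1)
      finally show ?thesis .
    qed
    have "(\<integral>\<^sup>+\<omega>. exp_neg (\<integral>\<^sup>+x. f n x \<partial>count_space (\<Phi> \<omega>)) \<partial>M)
        = (\<integral>\<^sup>+\<omega>. (\<Prod>i<k. exp_neg (c i) ^ card (\<Phi> \<omega> \<inter> B i)) \<partial>M)"
      unfolding fn using B poisson_point_process_locally_finite[OF ppp]
      by (intro nn_integral_cong)
         (subst nn_integral_count_space_steps, auto simp: exp_neg_sum exp_neg_mult_of_nat)
    also have "\<dots> = (\<Prod>i<k. \<integral>\<^sup>+\<omega>. exp_neg (c i) ^ card (\<Phi> \<omega> \<inter> B i) \<partial>M)"
      by (intro indep_vars_nn_integral indep_vars_compose2[OF indep]) auto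
    also have "\<dots> = exp_neg (\<Sum>i<k. ennreal lam * ((1 - exp_neg (c i)) * emeasure lborel (B i)))"
      by (simp add: exp_neg_sum pgf)
    also have "(\<Sum>i<k. ennreal lam * ((1 - exp_neg (c i)) * emeasure lborel (B i)))
        = ennreal lam * (\<integral>\<^sup>+x. (\<Sum>i<k. (1 - exp_neg (c i)) * indicator (B i) x) \<partial>lborel)"
      using B by (subst nn_integral_sum) (auto simp: nn_integral_cmult_indicator sum_distrib_left)
    also have "(\<lambda>x. \<Sum>i<k. (1 - exp_neg (c i)) * indicator (B i) x) = (\<lambda>x. 1 - exp_neg (f n x))"
      unfolding fn using disjoint_steps_comp[OF disj, of "\<lambda>t. 1 - exp_neg t"] by auto
    finally show ?thesis .
  qed
  have lim_sum: "(\<lambda>n. exp_neg (\<integral>\<^sup>+x. f n x \<partial>count_space S)) \<longlonglongrightarrow> exp_neg (\<integral>\<^sup>+x. h x \<partial>count_space S)" for S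
  proof -
    have "(\<integral>\<^sup>+x. h x \<partial>count_space S) = (SUP n. \<integral>\<^sup>+x. f n x \<partial>count_space S)"
      unfolding f(4)[symmetric] by (rule nn_integral_monotone_convergence_SUP[OF f(3)]) simp
    moreover have "incseq (\<lambda>n. \<integral>\<^sup>+x. f n x \<partial>count_space S)"
      using f(3) by (auto simp: incseq_def le_fun_def intro!: nn_integral_mono)
    ultimately show ?thesis
      using exp_neg_SUP_LIMSEQ by simp
  qed
  have "(\<lambda>n. \<integral>\<^sup>+\<omega>. exp_neg (\<integral>\<^sup>+x. f n x \<partial>count_space (\<Phi> \<omega>)) \<partial>M)
      \<longlonglongrightarrow> (\<integral>\<^sup>+\<omega>. exp_neg (\<integral>\<^sup>+x. h x \<partial>count_space (\<Phi> \<omega>)) \<partial>M)"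
  \<comment> \<open>These integrands decrease in \<open>n\<close>, so monotone convergence from
    below does not apply; the constant 1 dominates them on a probability space.\<close>
  proof (rule nn_integral_dominated_convergence[where w = "\<lambda>_. 1"])
    show "(\<integral>\<^sup>+\<omega>. 1 \<partial>M) < \<infinity>" by (simp add: emeasure_space_1)
    show "(\<lambda>\<omega>. exp_neg (\<integral>\<^sup>+x. f n x \<partial>count_space (\<Phi> \<omega>))) \<in> borel_measurable M" for n
      by (intro measurable_compose[OF measurable_poisson_sum[OF ppp] measurable_exp_neg] f_meas)
    show "(\<lambda>\<omega>. exp_neg (\<integral>\<^sup>+x. h x \<partial>count_space (\<Phi> \<omega>))) \<in> borel_measurable M"
      by (intro measurable_compose[OF measurable_poisson_sum[OF ppp] measurable_exp_neg] h)
    show "AE \<omega> in M. (\<lambda>n. exp_neg (\<integral>\<^sup>+x. f n x \<partial>count_space (\<Phi> \<omega>)))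
        \<longlonglongrightarrow> exp_neg (\<integral>\<^sup>+x. h x \<partial>count_space (\<Phi> \<omega>))"
      by (intro AE_I2 lim_sum)
  qed (simp_all add: exp_neg_le_1)
  moreover have "(\<lambda>n. exp_neg (ennreal lam * (\<integral>\<^sup>+x. 1 - exp_neg (f n x) \<partial>lborel)))
      \<longlonglongrightarrow> exp_neg (ennreal lam * (\<integral>\<^sup>+x. 1 - exp_neg (h x) \<partial>lborel))"
  \<comment> \<open>Here the integrands \<open>1 - exp_neg (f n x)\<close> increase in
    \<open>n\<close>, which matters because Lebesgue measure is infinite.\<close>
  proof (intro tendsto_exp_neg ennreal_tendsto_cmult nn_integral_LIMSEQ)
    show "incseq (\<lambda>n x. 1 - exp_neg (f n x))"
      using f(3) by (auto simp: incseq_def le_fun_def intro!: ennreal_mono_minus exp_neg_antimono)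
    show "(\<lambda>n. 1 - exp_neg (f n x)) \<longlonglongrightarrow> 1 - exp_neg (h x)" for x
    proof -
      have "incseq (\<lambda>n. f n x)"
        using f(3) by (auto simp: incseq_def le_fun_def)
      then have "(\<lambda>n. exp_neg (f n x)) \<longlonglongrightarrow> exp_neg (h x)"
        using exp_neg_SUP_LIMSEQ f(4) by metis
      then show ?thesis
        by (intro tendsto_diff_ennreal_general) auto
    qed
  qed auto
  ultimately show ?thesis
    unfolding step by (rule LIMSEQ_unique)
qed

end

section \<open>Translation invariance of the law of sums over a Poisson process\<close>

lemma measure_lborel_shift:
  fixes B :: "point set"
  assumes "B \<in> sets borel"
  shows "measure lborel {e. e - x \<in> B} = measure lborel B"
proof -
  have "emeasure lborel B = emeasure (distr lborel borel ((+) (- x))) B"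
    by (simp add: lborel_distr_plus)
  also have "\<dots> = emeasure lborel {e. e - x \<in> B}"
    using assms by (subst emeasure_distr) (auto intro!: arg_cong[where f = "emeasure lborel"])
  finally show ?thesis by (simp add: measure_def)
qed

context prob_space
begin

text \<open>The counts in disjoint sets have as joint law the product of their Poisson laws, which
  depend on the sets only through their areas. The weighted sum is a fixed measurable function
  \<open>T\<close> of these counts, so its law depends only on the areas too.\<close>

lemma distr_poisson_step_sum_cong:
  fixes B B' :: "nat \<Rightarrow> point set" and c :: "nat \<Rightarrow> ennreal"
  assumes ppp: "poisson_point_process lam \<Phi>"
    and B: "\<And>i. i < k \<Longrightarrow> B i \<in> sets borel" "\<And>i. i < k \<Longrightarrow> bounded (B i)" "disjoint_family_on B {..<k}"
    and B': "\<And>i. i < k \<Longrightarrow> B' i \<in> sets borel" "\<And>i. i < k \<Longrightarrow> bounded (B' i)" "disjoint_family_on B' {..<k}"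
    and eq: "\<And>i. i < k \<Longrightarrow> measure lborel (B i) = measure lborel (B' i)"
  shows "distr M borel (\<lambda>\<omega>. \<Sum>i<k. c i * of_nat (card (\<Phi> \<omega> \<inter> B i)))
    = distr M borel (\<lambda>\<omega>. \<Sum>i<k. c i * of_nat (card (\<Phi> \<omega> \<inter> B' i)))"
\<comment> \<open>The product characterisation of independence needs a nonempty index set; for
  \<open>k = 0\<close> both sums are 0.\<close>
proof (cases "k = 0")
  case False
  let ?N = "\<lambda>_::nat. count_space (UNIV :: nat set)"
  define T where "T v = (\<Sum>i<k. c i * of_nat (v i))" for v :: "nat \<Rightarrow> nat"
  have T [measurable]: "T \<in> PiM {..<k} ?N \<rightarrow>\<^sub>M borel"
    unfolding T_def by measurable
  have law: "distr M borel (\<lambda>\<omega>. \<Sum>i<k. c i * of_nat (card (\<Phi> \<omega> \<inter> A i)))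
      = distr (PiM {..<k} (\<lambda>i. distr M (?N i) (\<lambda>\<omega>. card (\<Phi> \<omega> \<inter> A i)))) borel T"
    if A: "\<And>i. i < k \<Longrightarrow> A i \<in> sets borel" "\<And>i. i < k \<Longrightarrow> bounded (A i)" "disjoint_family_on A {..<k}"
    for A :: "nat \<Rightarrow> point set"
  proof -
    let ?X = "\<lambda>i \<omega>. card (\<Phi> \<omega> \<inter> A i)"
    have rv: "random_variable (?N i) (?X i)" if "i \<in> {..<k}" for i
      using measurable_poisson_card[OF ppp] A(1,2) that by simp
    have "indep_vars ?N ?X {..<k}"
      using ppp A unfolding poisson_point_process_def by blast
    then have "distr M (PiM {..<k} ?N) (\<lambda>\<omega>. \<lambda>i\<in>{..<k}. ?X i \<omega>) = PiM {..<k} (\<lambda>i. distr M (?N i) (?X i))"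
      using indep_vars_iff_distr_eq_PiM'[where I = "{..<k}" and M' = ?N and X = ?X] rv False by auto
    then have "distr (PiM {..<k} (\<lambda>i. distr M (?N i) (?X i))) borel T
        = distr (distr M (PiM {..<k} ?N) (\<lambda>\<omega>. \<lambda>i\<in>{..<k}. ?X i \<omega>)) borel T"
      by simp
    also have "\<dots> = distr M borel (T \<circ> (\<lambda>\<omega>. \<lambda>i\<in>{..<k}. ?X i \<omega>))"
      by (intro distr_distr T measurable_restrict rv)
    also have "T \<circ> (\<lambda>\<omega>. \<lambda>i\<in>{..<k}. ?X i \<omega>) = (\<lambda>\<omega>. \<Sum>i<k. c i * of_nat (?X i \<omega>))"
      by (auto simp: T_def)
    finally show ?thesis ..
  qed
  have "distr M (?N i) (\<lambda>\<omega>. card (\<Phi> \<omega> \<inter> B i)) = distr M (?N i) (\<lambda>\<omega>. card (\<Phi> \<omega> \<inter> B' i))"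
    if "i \<in> {..<k}" for i
  proof (rule measure_eqI_countable[of _ UNIV])
    fix n :: nat
    have "emeasure (distr M (?N i) (\<lambda>\<omega>. card (\<Phi> \<omega> \<inter> A))) {n}
        = emeasure M {\<omega> \<in> space M. card (\<Phi> \<omega> \<inter> A) = n}" if "A \<in> sets borel" "bounded A" for A
      using measurable_poisson_card[OF ppp that]
      by (subst emeasure_distr) (auto intro!: arg_cong[where f = "emeasure M"])
    then show "emeasure (distr M (?N i) (\<lambda>\<omega>. card (\<Phi> \<omega> \<inter> B i))) {n}
        = emeasure (distr M (?N i) (\<lambda>\<omega>. card (\<Phi> \<omega> \<inter> B' i))) {n}"
      using B B' eq that by (simp add: emeasure_poisson_card[OF ppp])
  qed auto
  then have "PiM {..<k} (\<lambda>i. distr M (?N i) (\<lambda>\<omega>. card (\<Phi> \<omega> \<inter> B i)))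
      = PiM {..<k} (\<lambda>i. distr M (?N i) (\<lambda>\<omega>. card (\<Phi> \<omega> \<inter> B' i)))"
    by (intro PiM_cong) auto
  then show ?thesis
    by (simp only: law[OF B] law[OF B'])
qed simp

text \<open>Stationarity, in the form needed for the interference. Translating a step function moves
  its sets without changing their areas, so the law of its sum stays the same. In the limit the
  upper tails of the sums converge, and tails determine a law.\<close>

lemma distr_poisson_sum_shift:
  assumes ppp: "poisson_point_process lam \<Phi>" and h [measurable]: "h \<in> borel_measurable borel"
  shows "distr M borel (\<lambda>\<omega>. \<integral>\<^sup>+e. h (e - x) \<partial>count_space (\<Phi> \<omega>))
    = distr M borel (\<lambda>\<omega>. \<integral>\<^sup>+e. h e \<partial>count_space (\<Phi> \<omega>))"
proof -
  obtain f where f: "\<And>n. simple_function borel (f n)" "\<And>n. bounded {x. f n x \<noteq> 0}"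
    "incseq f" "\<And>x. (SUP n. f n x) = h x"
    using borel_measurable_bounded_simple_sequence[OF h] by metis
  note f_meas [measurable] = borel_measurable_simple_function[OF f(1)]
  have step: "distr M borel (\<lambda>\<omega>. \<integral>\<^sup>+e. f n (e - x) \<partial>count_space (\<Phi> \<omega>))
      = distr M borel (\<lambda>\<omega>. \<integral>\<^sup>+e. f n e \<partial>count_space (\<Phi> \<omega>))" for n
  proof -
    obtain k :: nat and B c where "\<forall>i<k. B i \<in> sets borel \<and> bounded (B i)"
      and disj: "disjoint_family_on B {..<k}"
      and fn: "f n = (\<lambda>x. \<Sum>i<k. c i * indicator (B i) x)"
      using simple_function_bounded_steps[OF f(1,2)] by blast
    from this(1) have B: "\<And>i. i < k \<Longrightarrow> B i \<in> sets borel" "\<And>i. i < k \<Longrightarrow> bounded (B i)"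
      by blast+
    define B' where "B' i = {e. e - x \<in> B i}" for i
    have B': "B' i \<in> sets borel" "bounded (B' i)" "measure lborel (B' i) = measure lborel (B i)"
      if i: "i < k" for i
    proof -
      have "(\<lambda>e. e - x) -` B i \<inter> space borel \<in> sets borel"
        using B(1)[OF i] by (intro measurable_sets) auto
      then show "B' i \<in> sets borel" by (simp add: B'_def vimage_def)
      have "B' i = (+) x ` B i"
        by (auto simp: B'_def image_iff intro!: bexI[where x = "_ - x"])
      then show "bounded (B' i)" using B(2)[OF i] by (simp add: bounded_translation)
      show "measure lborel (B' i) = measure lborel (B i)"
        unfolding B'_def by (rule measure_lborel_shift[OF B(1)[OF i]])
    qed
    have disj': "disjoint_family_on B' {..<k}"
      using disj by (auto simp: disjoint_family_on_def B'_def)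
    have fn': "f n (e - x) = (\<Sum>i<k. c i * indicator (B' i) e)" for e
      by (simp add: fn B'_def indicator_def)
    have "distr M borel (\<lambda>\<omega>. \<integral>\<^sup>+e. f n (e - x) \<partial>count_space (\<Phi> \<omega>))
        = distr M borel (\<lambda>\<omega>. \<Sum>i<k. c i * of_nat (card (\<Phi> \<omega> \<inter> B' i)))"
      unfolding fn' using B' poisson_point_process_locally_finite[OF ppp]
      by (intro distr_cong refl nn_integral_count_space_steps) auto
    also have "\<dots> = distr M borel (\<lambda>\<omega>. \<Sum>i<k. c i * of_nat (card (\<Phi> \<omega> \<inter> B i)))"
      by (intro distr_poisson_step_sum_cong[OF ppp] B B' disj disj')
    also have "\<dots> = distr M borel (\<lambda>\<omega>. \<integral>\<^sup>+e. f n e \<partial>count_space (\<Phi> \<omega>))"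
      unfolding fn using B poisson_point_process_locally_finite[OF ppp]
      by (intro distr_cong refl nn_integral_count_space_steps[symmetric]) auto
    finally show ?thesis .
  qed
  \<comment> \<open>The tails are strict because a supremum exceeds \<open>t\<close> exactly when
    some member does; the events therefore increase to their limit.\<close>
  have tail: "emeasure (distr M borel (\<lambda>\<omega>. \<integral>\<^sup>+e. h (e - y) \<partial>count_space (\<Phi> \<omega>))) {t<..}
      = (SUP n. emeasure (distr M borel (\<lambda>\<omega>. \<integral>\<^sup>+e. f n (e - y) \<partial>count_space (\<Phi> \<omega>))) {t<..})"
    for y t
  proof -
    let ?S = "\<lambda>g \<omega>. \<integral>\<^sup>+e. g (e - y) \<partial>count_space (\<Phi> \<omega>)"
    have meas [measurable]: "?S g \<in> borel_measurable M" if [measurable]: "g \<in> borel_measurable borel" for g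
      by (rule measurable_poisson_sum[OF ppp]) measurable
    have S_SUP: "?S h \<omega> = (SUP n. ?S (f n) \<omega>)" for \<omega>
      unfolding f(4)[symmetric] using f(3)
      by (intro nn_integral_monotone_convergence_SUP) (auto simp: incseq_def le_fun_def)
    have "emeasure (distr M borel (?S h)) {t<..} = emeasure M {\<omega> \<in> space M. t < ?S h \<omega>}"
      by (subst emeasure_distr) (auto intro!: arg_cong[where f = "emeasure M"])
    also have "{\<omega> \<in> space M. t < ?S h \<omega>} = (\<Union>n. {\<omega> \<in> space M. t < ?S (f n) \<omega>})"
      unfolding S_SUP by (auto simp: less_SUP_iff)
    also have "emeasure M \<dots> = (SUP n. emeasure M {\<omega> \<in> space M. t < ?S (f n) \<omega>})"
    proof (rule SUP_emeasure_incseq[symmetric])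
      have "?S (f m) \<omega> \<le> ?S (f n) \<omega>" if "m \<le> n" for m n \<omega>
        using f(3) that by (intro nn_integral_mono) (auto simp: incseq_def le_fun_def)
      then show "incseq (\<lambda>n. {\<omega> \<in> space M. t < ?S (f n) \<omega>})"
        unfolding incseq_def by (auto intro: less_le_trans)
    qed auto
    also have "\<dots> = (SUP n. emeasure (distr M borel (?S (f n))) {t<..})"
      by (intro SUP_cong refl, subst emeasure_distr) (auto intro!: arg_cong[where f = "emeasure M"])
    finally show ?thesis .
  qed
  show ?thesis
  \<comment> \<open>\<open>UNIV\<close> is added to the generator to supply a cover by a set of
    finite measure: no open upper half-line contains 0.\<close>
  proof (rule measure_eqI_generator_eq[where A = "\<lambda>_. UNIV" and E = "insert UNIV (range greaterThan)"])
    have meas: "(\<lambda>\<omega>. \<integral>\<^sup>+e. h (e - y) \<partial>count_space (\<Phi> \<omega>)) \<in> borel_measurable M" for y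
      by (rule measurable_poisson_sum[OF ppp]) measurable
    have total: "emeasure (distr M borel (\<lambda>\<omega>. \<integral>\<^sup>+e. h (e - y) \<partial>count_space (\<Phi> \<omega>))) UNIV = 1" for y
      using prob_space.emeasure_space_1[OF prob_space_distr[OF meas]] by simp
    then show "emeasure (distr M borel (\<lambda>\<omega>. \<integral>\<^sup>+e. h (e - x) \<partial>count_space (\<Phi> \<omega>))) UNIV \<noteq> \<infinity>"
      by simp
    show "emeasure (distr M borel (\<lambda>\<omega>. \<integral>\<^sup>+e. h (e - x) \<partial>count_space (\<Phi> \<omega>))) X
        = emeasure (distr M borel (\<lambda>\<omega>. \<integral>\<^sup>+e. h e \<partial>count_space (\<Phi> \<omega>))) X"
      if "X \<in> insert UNIV (range greaterThan)" for X
      using that total[of x] total[of 0] tail[of x] tail[of 0] by (auto simp: step)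
    have "{s<..} \<inter> {t<..} = {max s t<..}" for s t :: ennreal
      by auto
    then have "Int_stable (range greaterThan :: ennreal set set)"
      by (simp add: Int_stable_def)
    then show "Int_stable (insert UNIV (range greaterThan) :: ennreal set set)"
      by (auto simp: Int_stable_def)
    have "sets (borel :: ennreal measure) = sigma_sets UNIV (range greaterThan)"
      by (subst borel_Ioi) simp
    also have "\<dots> = sigma_sets UNIV (insert UNIV (range greaterThan))"
      by (rule sigma_sets_eqI) (auto intro: sigma_sets_top)
    finally show "sets (distr M borel (\<lambda>\<omega>. \<integral>\<^sup>+e. h (e - x) \<partial>count_space (\<Phi> \<omega>)))
        = sigma_sets UNIV (insert UNIV (range greaterThan))"
      and "sets (distr M borel (\<lambda>\<omega>. \<integral>\<^sup>+e. h e \<partial>count_space (\<Phi> \<omega>)))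
        = sigma_sets UNIV (insert UNIV (range greaterThan))"
      by simp_all
  qed auto
qed

text \<open>By independence the joint law of the two configurations is a product. With the
  realisation of \<open>\<Psi>\<close> held fixed, Campbell's formula applies to
  \<open>\<Phi>\<close>, and Tonelli then exchanges the integral over the plane with the expectation
  over \<open>\<Psi>\<close>.\<close>

lemma
  assumes ppp: "poisson_point_process lam \<Phi>" and "0 \<le> lam"
    and indep: "indep_var configurations \<Phi> configurations \<Psi>"
    and f [measurable]: "f \<in> borel_measurable (borel \<Otimes>\<^sub>M configurations)"
  shows measurable_campbell_indep:
      "(\<lambda>\<omega>. \<integral>\<^sup>+x. f (x, \<Psi> \<omega>) \<partial>count_space (\<Phi> \<omega>)) \<in> borel_measurable M"
    and campbell_indep:
      "(\<integral>\<^sup>+\<omega>. \<integral>\<^sup>+x. f (x, \<Psi> \<omega>) \<partial>count_space (\<Phi> \<omega>) \<partial>M)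
        = ennreal lam * (\<integral>\<^sup>+x. \<integral>\<^sup>+\<omega>. f (x, \<Psi> \<omega>) \<partial>M \<partial>lborel)"
proof -
  note [measurable] = indep_var_rv1[OF indep] indep_var_rv2[OF indep]
  define F where "F p = (\<integral>\<^sup>+x. f (x, snd p) \<partial>count_space (fst p))" for p
  have F [measurable]: "F \<in> borel_measurable (configurations \<Otimes>\<^sub>M configurations)"
    unfolding F_def
    using measurable_sum_configuration[where T = fst and f = "\<lambda>(x, p). f (x, snd p)"
        and N = "configurations \<Otimes>\<^sub>M configurations"] by simp
  have "(\<lambda>\<omega>. F (\<Phi> \<omega>, \<Psi> \<omega>)) \<in> borel_measurable M"
    by measurable
  then show "(\<lambda>\<omega>. \<integral>\<^sup>+x. f (x, \<Psi> \<omega>) \<partial>count_space (\<Phi> \<omega>)) \<in> borel_measurable M"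
    by (simp add: F_def)
  let ?D1 = "distr M configurations \<Phi>" and ?D2 = "distr M configurations \<Psi>"
  interpret D1: prob_space ?D1 by (rule prob_space_distr) measurable
  interpret D2: prob_space ?D2 by (rule prob_space_distr) measurable
  interpret pair_sigma_finite ?D1 ?D2 ..
  interpret L: pair_sigma_finite "lborel :: point measure" ?D2 ..
  have "(\<integral>\<^sup>+\<omega>. \<integral>\<^sup>+x. f (x, \<Psi> \<omega>) \<partial>count_space (\<Phi> \<omega>) \<partial>M) = (\<integral>\<^sup>+\<omega>. F (\<Phi> \<omega>, \<Psi> \<omega>) \<partial>M)"
    by (simp add: F_def)
  also have "\<dots> = (\<integral>\<^sup>+p. F p \<partial>distr M (configurations \<Otimes>\<^sub>M configurations) (\<lambda>\<omega>. (\<Phi> \<omega>, \<Psi> \<omega>)))"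
    by (subst nn_integral_distr) measurable
  also have "\<dots> = (\<integral>\<^sup>+p. F p \<partial>(?D1 \<Otimes>\<^sub>M ?D2))"
    using indep by (simp add: indep_var_distribution_eq)
  also have "\<dots> = (\<integral>\<^sup>+E. \<integral>\<^sup>+S. F (S, E) \<partial>?D1 \<partial>?D2)"
    by (rule nn_integral_snd[symmetric]) (simp add: F cong: measurable_cong_sets)
  also have "\<dots> = (\<integral>\<^sup>+E. ennreal lam * (\<integral>\<^sup>+x. f (x, E) \<partial>lborel) \<partial>?D2)"
  proof (rule nn_integral_cong)
    fix E assume "E \<in> space ?D2"
    then have [measurable]: "E \<in> space configurations" by simp
    have "(\<integral>\<^sup>+S. F (S, E) \<partial>?D1) = (\<integral>\<^sup>+\<omega>. \<integral>\<^sup>+x. f (x, E) \<partial>count_space (\<Phi> \<omega>) \<partial>M)"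
      by (subst nn_integral_distr, measurable) (simp add: F_def)
    also have "\<dots> = ennreal lam * (\<integral>\<^sup>+x. f (x, E) \<partial>lborel)"
      by (rule campbell[OF ppp \<open>0 \<le> lam\<close>]) measurable
    finally show "(\<integral>\<^sup>+S. F (S, E) \<partial>?D1) = ennreal lam * (\<integral>\<^sup>+x. f (x, E) \<partial>lborel)" .
  qed
  also have "\<dots> = ennreal lam * (\<integral>\<^sup>+E. \<integral>\<^sup>+x. f (x, E) \<partial>lborel \<partial>?D2)"
    by (rule nn_integral_cmult) measurable
  also have "(\<integral>\<^sup>+E. \<integral>\<^sup>+x. f (x, E) \<partial>lborel \<partial>?D2) = (\<integral>\<^sup>+x. \<integral>\<^sup>+E. f (x, E) \<partial>?D2 \<partial>lborel)"
    by (rule L.Fubini') (simp add: case_prod_unfold f cong: measurable_cong_sets)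
  also have "\<dots> = (\<integral>\<^sup>+x. \<integral>\<^sup>+\<omega>. f (x, \<Psi> \<omega>) \<partial>M \<partial>lborel)"
    by (intro nn_integral_cong, subst nn_integral_distr) measurable
  finally show "(\<integral>\<^sup>+\<omega>. \<integral>\<^sup>+x. f (x, \<Psi> \<omega>) \<partial>count_space (\<Phi> \<omega>) \<partial>M)
      = ennreal lam * (\<integral>\<^sup>+x. \<integral>\<^sup>+\<omega>. f (x, \<Psi> \<omega>) \<partial>M \<partial>lborel)" .
qed

end

section \<open>Secure links\<close>

lemma capacity_ennreal: "0 \<le> r \<Longrightarrow> capacity (ennreal r) = ereal (log 2 (1 + r))"
  by (simp add: capacity_def)

lemma capacity_less_iff:
  assumes "s \<noteq> \<infinity>"
  shows "capacity t < capacity s \<longleftrightarrow> t < s"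
proof (cases t)
  case (real q)
  obtain r where r: "s = ennreal r" "0 \<le> r"
    using assms by (cases s) auto
  have "log 2 (1 + q) < log 2 (1 + r) \<longleftrightarrow> q < r"
    using real r by (subst log_less_cancel_iff) auto
  then show ?thesis
    unfolding real(2) r(1) capacity_ennreal[OF real(1)] capacity_ennreal[OF r(2)]
    by (simp only: less_ereal.simps(1) ennreal_less_iff[OF real(1)])
next
  case top
  then show ?thesis
    using assms by (simp add: capacity_def)
qed

text \<open>Equal noise powers turn both signal-to-noise ratios into the same positive finite
  multiple of the gains, and the capacity is strictly increasing, so the sign of the difference is
  decided by the gains alone.\<close>

lemma secrecy_rate_pos_iff:
  assumes "P > 0" "\<sigma>l\<^sup>2 = \<sigma>e\<^sup>2" "\<sigma>e > 0" "g (dist x y) \<noteq> \<infinity>"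
  shows "ereal 0 < secrecy_rate g P \<sigma>l \<sigma>e E x y \<longleftrightarrow> (\<Sum>\<^sub>\<infinity>e\<in>E. g (dist x e)) < g (dist x y)"
proof -
  define snr where "snr t = ennreal P * t / ennreal (\<sigma>e\<^sup>2)" for t
  have ratio: "ennreal P / ennreal (\<sigma>e\<^sup>2) = ennreal (P / \<sigma>e\<^sup>2)"
    using assms by (intro divide_ennreal) auto
  have snr: "snr t = ennreal (P / \<sigma>e\<^sup>2) * t" for t
    unfolding snr_def ratio[symmetric] by (metis ennreal_times_divide mult.commute)
  have "ennreal (P / \<sigma>e\<^sup>2) \<noteq> \<infinity>" "ennreal (P / \<sigma>e\<^sup>2) \<noteq> 0"
    using assms by auto
  then have snr_less: "snr s < snr t \<longleftrightarrow> s < t" for s t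
    unfolding snr
    using ennreal_mult_strict_left_mono[of s t "ennreal (P / \<sigma>e\<^sup>2)"]
      mult_left_mono[of t s "ennreal (P / \<sigma>e\<^sup>2)"]
    by (metis infinity_ennreal_def not_less top.not_eq_extremum zero_le zero_less_iff_neq_zero)
  have fin: "snr (g (dist x y)) \<noteq> \<infinity>"
    unfolding snr using assms(4) by (simp add: ennreal_mult_eq_top_iff)
  \<comment> \<open>With a finite minuend the difference is positive exactly when the subtrahend is
    smaller, and an infinite subtrahend causes no ambiguity.\<close>
  then have "\<bar>capacity (snr (g (dist x y)))\<bar> \<noteq> \<infinity>"
    by (simp add: capacity_def)
  then have "ereal 0 < secrecy_rate g P \<sigma>l \<sigma>e E x y
      \<longleftrightarrow> capacity (snr (\<Sum>\<^sub>\<infinity>e\<in>E. g (dist x e))) < capacity (snr (g (dist x y)))"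
    unfolding secrecy_rate_def assms(2) snr_def[symmetric]
    by (cases "capacity (snr (g (dist x y)))"; cases "capacity (snr (\<Sum>\<^sub>\<infinity>e\<in>E. g (dist x e)))")
       (auto simp: less_max_iff_disj zero_ereal_def)
  then show ?thesis
    by (simp add: capacity_less_iff[OF fin] snr_less)
qed

text \<open>The edge relation in a form suited to integration: a counting-measure integral replaces
  the infinite sum, and differences of points replace distances so that translations can be applied.
  The clause \<open>x \<noteq> y\<close> is explicit because the gain at distance 0 is infinite and
  would link a node with finite interference to itself.\<close>

definition secure :: "real \<Rightarrow> point \<Rightarrow> point \<Rightarrow> point set \<Rightarrow> bool" where
  "secure b x y E \<longleftrightarrow> x \<noteq> y \<and>
     (\<integral>\<^sup>+e. power_law_gain b (norm (e - x)) \<partial>count_space E) < power_law_gain b (norm (y - x))"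

lemma power_law_gain_finite: "0 < r \<Longrightarrow> power_law_gain b r \<noteq> \<infinity>"
  by (simp add: power_law_gain_def ennreal_divide_eq_top_iff)

lemma iS_graph_power_law_iff:
  assumes "P > 0" "\<sigma>l\<^sup>2 = \<sigma>e\<^sup>2" "\<sigma>e > 0" "locally_finite E" "x \<in> L" "y \<in> L"
  shows "(x, y) \<in> iS_graph (power_law_gain b) P \<sigma>l \<sigma>e 0 L E \<longleftrightarrow> secure b x y E"
proof (cases "x = y")
  case False
  then have "ereal 0 < secrecy_rate (power_law_gain b) P \<sigma>l \<sigma>e E x y
      \<longleftrightarrow> (\<Sum>\<^sub>\<infinity>e\<in>E. power_law_gain b (dist x e)) < power_law_gain b (dist x y)"
    using assms by (intro secrecy_rate_pos_iff power_law_gain_finite) auto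
  then show ?thesis
    using assms False
    by (simp add: iS_graph_def secure_def infsum_eq_nn_integral_count_space dist_norm norm_minus_commute)
qed (simp add: iS_graph_def secure_def)

text \<open>Brings a degree into the shape of a sum over the legitimate nodes, as Campbell's formula
  requires.\<close>

lemma emeasure_count_space_Collect:
  "emeasure (count_space UNIV) {x \<in> L. Q x} = (\<integral>\<^sup>+x. indicator {x. Q x} x \<partial>count_space L)"
proof -
  have "(\<integral>\<^sup>+x. indicator {x. Q x} x \<partial>count_space L)
      = (\<integral>\<^sup>+x. indicator {x. Q x} x * indicator L x \<partial>count_space UNIV)"
    by (rule nn_integral_count_space_indicator) simp
  also have "\<dots> = (\<integral>\<^sup>+x. indicator {x \<in> L. Q x} x \<partial>count_space UNIV)"
    by (intro nn_integral_cong) (auto simp: indicator_def)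
  also have "\<dots> = emeasure (count_space UNIV) {x \<in> L. Q x}"
    by (rule nn_integral_indicator) simp
  finally show ?thesis ..
qed

lemma N_out_power_law:
  assumes "P > 0" "\<sigma>l\<^sup>2 = \<sigma>e\<^sup>2" "\<sigma>e > 0" "locally_finite E"
  shows "N_out (power_law_gain b) P \<sigma>l \<sigma>e 0 L E = (\<integral>\<^sup>+x. indicator {x. secure b 0 x E} x \<partial>count_space L)"
proof -
  have "{x \<in> L. (0, x) \<in> iS_graph (power_law_gain b) P \<sigma>l \<sigma>e 0 (L \<union> {0}) E} = {x \<in> L. secure b 0 x E}"
    using iS_graph_power_law_iff[OF assms, of 0 "L \<union> {0}"] by auto
  then show ?thesis
    unfolding N_out_def by (simp only: emeasure_count_space_Collect)
qed

lemma N_in_power_law: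
  assumes "P > 0" "\<sigma>l\<^sup>2 = \<sigma>e\<^sup>2" "\<sigma>e > 0" "locally_finite E"
  shows "N_in (power_law_gain b) P \<sigma>l \<sigma>e 0 L E = (\<integral>\<^sup>+x. indicator {x. secure b x 0 E} x \<partial>count_space L)"
proof -
  have "{x \<in> L. (x, 0) \<in> iS_graph (power_law_gain b) P \<sigma>l \<sigma>e 0 (L \<union> {0}) E} = {x \<in> L. secure b x 0 E}"
    using iS_graph_power_law_iff[OF assms, of _ "L \<union> {0}" 0] by auto
  then show ?thesis
    unfolding N_in_def by (simp only: emeasure_count_space_Collect)
qed

section \<open>Joint measurability of the edge relation\<close>

lemma measurable_interference [measurable]:
  "(\<lambda>(x, E). \<integral>\<^sup>+e. power_law_gain b (norm (e - x)) \<partial>count_space E)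
    \<in> borel_measurable (borel \<Otimes>\<^sub>M configurations)"
  using measurable_sum_configuration[where T = snd and N = "borel \<Otimes>\<^sub>M configurations"
      and f = "\<lambda>(e, p). power_law_gain b (norm (e - fst p))"]
  by (simp add: case_prod_unfold)

lemma measurable_secure:
  shows "(\<lambda>(x, E). indicator {x. secure b 0 x E} x :: ennreal) \<in> borel_measurable (borel \<Otimes>\<^sub>M configurations)"
    and "(\<lambda>(x, E). indicator {x. secure b x 0 E} x :: ennreal) \<in> borel_measurable (borel \<Otimes>\<^sub>M configurations)"
proof -
  define I :: "point \<times> point set \<Rightarrow> ennreal"
    where "I = (\<lambda>(x, E). \<integral>\<^sup>+e. power_law_gain b (norm (e - x)) \<partial>count_space E)"
  have I [measurable]: "I \<in> borel_measurable (borel \<Otimes>\<^sub>M configurations)"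
    unfolding I_def by (rule measurable_interference)
  have I0 [measurable]: "(\<lambda>p. I (0, snd p)) \<in> borel_measurable (borel \<Otimes>\<^sub>M configurations)"
    by (rule measurable_compose[OF _ I]) measurable
  have "(\<lambda>(x, E). indicator {x. secure b 0 x E} x :: ennreal)
      = (\<lambda>p. if 0 < norm (fst p) \<and> I (0, snd p) < power_law_gain b (norm (fst p)) then 1 else 0)"
    by (auto simp: fun_eq_iff indicator_def secure_def I_def)
  also have "\<dots> \<in> borel_measurable (borel \<Otimes>\<^sub>M configurations)"
    by measurable
  finally show "(\<lambda>(x, E). indicator {x. secure b 0 x E} x :: ennreal) \<in> borel_measurable (borel \<Otimes>\<^sub>M configurations)" .
  have "(\<lambda>(x, E). indicator {x. secure b x 0 E} x :: ennreal)
      = (\<lambda>p. if 0 < norm (fst p) \<and> I p < power_law_gain b (norm (fst p)) then 1 else 0)"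
    by (auto simp: fun_eq_iff indicator_def secure_def I_def)
  also have "\<dots> \<in> borel_measurable (borel \<Otimes>\<^sub>M configurations)"
    by measurable
  finally show "(\<lambda>(x, E). indicator {x. secure b x 0 E} x :: ennreal) \<in> borel_measurable (borel \<Otimes>\<^sub>M configurations)" .
qed

section \<open>Expected area of the secure region\<close>

text \<open>If the interference \<open>S\<close> at the origin is positive and finite, the secure
  points form a punctured disc of area \<open>pi * S powr (- (1 / b))\<close>. The right side
  expresses this negative power through exponentials of \<open>S\<close>, whose expectations the
  Laplace functional provides.\<close>

lemma secure_area:
  fixes b :: real
  assumes "1 < b"
  shows "ennreal (Gamma (1 + 1 / b)) * (\<integral>\<^sup>+x. indicator {x. secure b 0 x E} x \<partial>lborel)
    = (\<integral>\<^sup>+(x::point). exp_neg (ennreal (norm x powr (2 * b)) *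
        (\<integral>\<^sup>+e. power_law_gain b (norm e) \<partial>count_space E)) \<partial>lborel)"
proof -
  define S where "S = (\<integral>\<^sup>+e. power_law_gain b (norm e) \<partial>count_space E)"
  have secure: "secure b 0 x E \<longleftrightarrow> x \<noteq> 0 \<and> S < power_law_gain b (norm x)" for x
    by (auto simp: secure_def S_def)
  have G: "0 < Gamma (1 + 1 / b)"
    using assms by (intro Gamma_real_pos) (simp add: add_pos_pos)
  have infinite_area: "emeasure lborel (UNIV :: point set) = \<infinity>"
    by simp
  \<comment> \<open>In the two extreme cases both sides agree as well: they are 0 for infinite
    interference and infinite for zero interference.\<close>
  consider "S = \<infinity>" | "S = 0" | s where "S = ennreal s" "0 < s"
    by (cases S) (auto simp: less_le)
  then have "ennreal (Gamma (1 + 1 / b)) * (\<integral>\<^sup>+x. indicator {x. secure b 0 x E} x \<partial>lborel)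
      = (\<integral>\<^sup>+(x::point). exp_neg (ennreal (norm x powr (2 * b)) * S) \<partial>lborel)"
  proof cases
    case 1
    have "(\<integral>\<^sup>+(x::point). exp_neg (ennreal (norm x powr (2 * b)) * S) \<partial>lborel) = (\<integral>\<^sup>+(x::point). 0 \<partial>lborel)"
      using AE_lborel_singleton[of "0::point"]
      by (intro nn_integral_cong_AE, eventually_elim) (simp add: 1 ennreal_mult_top)
    moreover have "{x. secure b 0 x E} = {}"
      by (simp add: secure 1)
    ultimately show ?thesis by simp
  next
    case 2
    have "(\<integral>\<^sup>+x. indicator {x. secure b 0 x E} x \<partial>lborel) = (\<integral>\<^sup>+(x::point). 1 \<partial>lborel)"
      using AE_lborel_singleton[of "0::point"]
      by (intro nn_integral_cong_AE, eventually_elim)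
         (simp add: secure 2 power_law_gain_def ennreal_zero_less_divide)
    then show ?thesis
      using G by (simp add: 2 infinite_area ennreal_mult_top)
  next
    case 3
    have "{x. secure b 0 x E} = ball 0 ((1 / s) powr (1 / (2 * b))) - {0}"
    proof (rule set_eqI)
      fix x :: point
      show "x \<in> {x. secure b 0 x E} \<longleftrightarrow> x \<in> ball 0 ((1 / s) powr (1 / (2 * b))) - {0}"
      proof (cases "x = 0")
        case False
        then have "S < power_law_gain b (norm x) \<longleftrightarrow> s < 1 / norm x powr (2 * b)"
          using 3 by (simp add: power_law_gain_def divide_ennreal ennreal_less_iff flip: ennreal_1)
        also have "\<dots> \<longleftrightarrow> norm x powr (2 * b) < ((1 / s) powr (1 / (2 * b))) powr (2 * b)"
          using assms 3 False by (simp add: powr_powr field_simps)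
        also have "\<dots> \<longleftrightarrow> norm x < (1 / s) powr (1 / (2 * b))"
          using assms by (intro powr_less_powr_iff) auto
        finally show ?thesis using False by (simp add: secure)
      qed (simp add: secure)
    qed
    then have "(\<integral>\<^sup>+x. indicator {x. secure b 0 x E} x \<partial>lborel)
        = emeasure lborel (ball (0::point) ((1 / s) powr (1 / (2 * b))) - {0})"
      by simp
    also have "\<dots> = emeasure lborel (ball (0::point) ((1 / s) powr (1 / (2 * b))))"
      by (rule emeasure_Diff_null_set) auto
    \<comment> \<open>The exponent is left in the shape \<open>2 / p\<close> with
      \<open>p = 2 * b\<close>, matching the planar integral that is used next.\<close>
    also have "\<dots> = ennreal (pi * s powr (- (2 / (2 * b))))"
      using assms 3
      by (simp add: emeasure_ball_point powr_powr powr_divide powr_minus field_simps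
          flip: powr_realpow powr_numeral)
    finally show ?thesis
      using 3 G assms nn_integral_exp_neg_powr_norm[of s "2 * b"]
      by (simp add: ennreal_mult[symmetric] mult_ac)
  qed
  then show ?thesis by (simp add: S_def)
qed

text \<open>Transferred from the complex identity. At integers both sides are 0, by the conventions
  for \<open>Gamma\<close> at its poles and for division by 0.\<close>

lemma Gamma_reflection_real:
  fixes u :: real
  shows "Gamma u * Gamma (1 - u) = pi / sin (pi * u)"
proof -
  have "complex_of_real (Gamma u * Gamma (1 - u))
      = Gamma (complex_of_real u) * Gamma (1 - complex_of_real u)"
    by (simp only: of_real_mult Gamma_complex_of_real[symmetric] of_real_diff of_real_1)
  also have "\<dots> = complex_of_real (pi / sin (pi * u))"
    by (simp only: Gamma_reflection_complex of_real_divide of_real_mult sin_of_real[symmetric])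
  finally show ?thesis
    by (rule of_real_eq_iff[THEN iffD1])
qed

context prob_space
begin

lemma expected_secure_area:
  assumes ppp: "poisson_point_process lam \<Psi>" and "0 < lam" "1 < b"
  shows "(\<integral>\<^sup>+x. \<integral>\<^sup>+\<omega>. indicator {x. secure b 0 x (\<Psi> \<omega>)} x \<partial>M \<partial>lborel)
    = ennreal (normalized_sinc (1 / b) / lam)"
proof -
  note [measurable] = poisson_point_process_measurable[OF ppp]
  interpret pair_sigma_finite "lborel :: point measure" M ..
  define S where "S \<omega> = (\<integral>\<^sup>+e. power_law_gain b (norm e) \<partial>count_space (\<Psi> \<omega>))" for \<omega>
  have S [measurable]: "S \<in> borel_measurable M"
    unfolding S_def by (rule measurable_poisson_sum[OF ppp]) measurable
  \<comment> \<open>The rate of the Gaussian: the Laplace exponent at parameter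
    \<open>norm x powr (2 * b)\<close> is \<open>\<kappa> * norm x powr 2\<close>, since the power
    \<open>1 / b\<close> of the parameter is \<open>norm x powr 2\<close>.\<close>
  define \<kappa> where "\<kappa> = lam * pi * Gamma (1 - 1 / b)"
  have "0 < 1 - 1 / b" "0 < 1 + 1 / b" using \<open>1 < b\<close> by (auto simp: add_pos_pos)
  then have G: "0 < Gamma (1 - 1 / b)" "0 < Gamma (1 + 1 / b)" by (auto intro: Gamma_real_pos)
  have "0 < \<kappa>" using G \<open>0 < lam\<close> by (simp add: \<kappa>_def)
  have laplace: "(\<integral>\<^sup>+\<omega>. exp_neg (ennreal (norm x powr (2 * b)) * S \<omega>) \<partial>M) = exp_neg (ennreal (\<kappa> * norm x powr 2))"
    if "x \<noteq> 0" for x :: point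
  proof -
    let ?s = "norm x powr (2 * b)"
    have "(\<integral>\<^sup>+\<omega>. exp_neg (ennreal ?s * S \<omega>) \<partial>M)
        = (\<integral>\<^sup>+\<omega>. exp_neg (\<integral>\<^sup>+e. ennreal ?s * power_law_gain b (norm e) \<partial>count_space (\<Psi> \<omega>)) \<partial>M)"
      by (simp add: S_def nn_integral_cmult)
    also have "\<dots> = exp_neg (ennreal lam * (\<integral>\<^sup>+(e::point). 1 - exp_neg (ennreal ?s * power_law_gain b (norm e)) \<partial>lborel))"
      using \<open>0 < lam\<close>
      by (intro laplace_functional[OF ppp, of "\<lambda>e. ennreal ?s * power_law_gain b (norm e)"]) auto
    also have "\<dots> = exp_neg (ennreal (\<kappa> * norm x powr 2))"
      using that \<open>0 < lam\<close> \<open>1 < b\<close> G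
      by (subst nn_integral_one_minus_exp_neg_gain) (simp_all add: \<kappa>_def powr_powr ennreal_mult[symmetric] mult_ac)
    finally show ?thesis .
  qed
  \<comment> \<open>The factor \<open>Gamma (1 + 1 / b)\<close> is carried along so that
    \<open>secure_area\<close> applies for every outcome; being positive and finite, it is cancelled
    at the end.\<close>
  have "ennreal (Gamma (1 + 1 / b)) * (\<integral>\<^sup>+x. \<integral>\<^sup>+\<omega>. indicator {x. secure b 0 x (\<Psi> \<omega>)} x \<partial>M \<partial>lborel)
      = ennreal (Gamma (1 + 1 / b)) * (\<integral>\<^sup>+\<omega>. \<integral>\<^sup>+x. indicator {x. secure b 0 x (\<Psi> \<omega>)} x \<partial>lborel \<partial>M)"
    using measurable_compose[OF _ measurable_secure(1), of "\<lambda>(x, \<omega>). (x, \<Psi> \<omega>)"]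
    by (subst Fubini') (auto simp: case_prod_unfold)
  also have "\<dots> = (\<integral>\<^sup>+\<omega>. ennreal (Gamma (1 + 1 / b)) * (\<integral>\<^sup>+x. indicator {x. secure b 0 x (\<Psi> \<omega>)} x \<partial>lborel) \<partial>M)"
    using measurable_compose[OF _ measurable_secure(1), of "\<lambda>(\<omega>, x). (x, \<Psi> \<omega>)" "M \<Otimes>\<^sub>M lborel"]
    by (intro nn_integral_cmult[symmetric] lborel.borel_measurable_nn_integral) (auto simp: case_prod_unfold)
  also have "\<dots> = (\<integral>\<^sup>+\<omega>. \<integral>\<^sup>+(x::point). exp_neg (ennreal (norm x powr (2 * b)) * S \<omega>) \<partial>lborel \<partial>M)"
    by (simp add: secure_area[OF \<open>1 < b\<close>] S_def)
  also have "\<dots> = (\<integral>\<^sup>+(x::point). \<integral>\<^sup>+\<omega>. exp_neg (ennreal (norm x powr (2 * b)) * S \<omega>) \<partial>M \<partial>lborel)"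
    by (rule Fubini') measurable
  also have "\<dots> = (\<integral>\<^sup>+(x::point). exp_neg (ennreal (\<kappa> * norm x powr 2)) \<partial>lborel)"
    using AE_lborel_singleton[of "0::point"]
    by (intro nn_integral_cong_AE, eventually_elim) (rule laplace)
  \<comment> \<open>The planar integral with \<open>p = 2\<close>, where the Gamma factor is
    \<open>Gamma 2 = 1\<close>.\<close>
  also have "\<dots> = ennreal (pi / \<kappa>)"
    using \<open>0 < \<kappa>\<close>
    by (subst nn_integral_exp_neg_powr_norm) (simp_all add: powr_minus Gamma_numeral divide_inverse)
  also have "\<dots> = ennreal (Gamma (1 + 1 / b)) * ennreal (pi / (\<kappa> * Gamma (1 + 1 / b)))"
    using G \<open>0 < \<kappa>\<close> by (simp add: ennreal_mult[symmetric])
  finally have "(\<integral>\<^sup>+x. \<integral>\<^sup>+\<omega>. indicator {x. secure b 0 x (\<Psi> \<omega>)} x \<partial>M \<partial>lborel)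
      = ennreal (pi / (\<kappa> * Gamma (1 + 1 / b)))"
    using G by (simp add: ennreal_mult_cancel_left)
  also have "pi / (\<kappa> * Gamma (1 + 1 / b)) = normalized_sinc (1 / b) / lam"
  proof -
    \<comment> \<open>With \<open>u = 1 / b\<close>, the recursion turns
      \<open>Gamma (1 + u) * Gamma (1 - u)\<close> into \<open>u * Gamma u * Gamma (1 - u)\<close>,
      to which the reflection formula applies.\<close>
    have "1 / b \<notin> \<int>\<^sub>\<le>\<^sub>0" using \<open>1 < b\<close> by auto
    then have "Gamma (1 + 1 / b) = 1 / b * Gamma (1 / b)"
      using Gamma_plus1[of "1 / b"] by (simp add: add.commute)
    moreover note Gamma_reflection_real[of "1 / b"]
    ultimately have "\<kappa> * Gamma (1 + 1 / b) = lam * pi * (1 / b) * (pi / sin (pi * (1 / b)))"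
      by (simp add: \<kappa>_def mult_ac)
    then show ?thesis
      by (simp add: normalized_sinc_def mult_ac)
  qed
  finally show ?thesis .
qed

text \<open>The gain of the link is the same in both directions. Only the centre of the interference
  sum moves, from \<open>x\<close> to the origin, and its law does not depend on the centre.\<close>

lemma secure_prob_swap:
  assumes ppp: "poisson_point_process lam \<Psi>"
  shows "(\<integral>\<^sup>+\<omega>. indicator {x. secure b x 0 (\<Psi> \<omega>)} x \<partial>M) = (\<integral>\<^sup>+\<omega>. indicator {x. secure b 0 x (\<Psi> \<omega>)} x \<partial>M)"
proof -
  define h where "h e = power_law_gain b (norm e)" for e :: point
  have h [measurable]: "h \<in> borel_measurable borel"
    unfolding h_def by measurable
  \<comment> \<open>For fixed \<open>x\<close> both edge events say that the interference lies in
    this one set, so equality of the laws gives equality of the probabilities.\<close>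
  define A where "A = {t. x \<noteq> 0 \<and> t < power_law_gain b (norm x)}"
  have A [measurable]: "A \<in> sets borel"
    unfolding A_def by measurable
  define S where "S y \<omega> = (\<integral>\<^sup>+e. h (e - y) \<partial>count_space (\<Psi> \<omega>))" for y \<omega>
  have S [measurable]: "S y \<in> borel_measurable M" for y
    unfolding S_def by (rule measurable_poisson_sum[OF ppp]) measurable
  have law: "distr M borel (S x) = distr M borel (S 0)"
    unfolding S_def using distr_poisson_sum_shift[OF ppp h] by simp
  have "(\<integral>\<^sup>+\<omega>. indicator {x. secure b x 0 (\<Psi> \<omega>)} x \<partial>M) = (\<integral>\<^sup>+\<omega>. indicator A (S x \<omega>) \<partial>M)"
    by (intro nn_integral_cong) (auto simp: secure_def A_def S_def h_def indicator_def)
  also have "\<dots> = (\<integral>\<^sup>+t. indicator A t \<partial>distr M borel (S x))"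
    by (subst nn_integral_distr) measurable
  also have "\<dots> = (\<integral>\<^sup>+\<omega>. indicator A (S 0 \<omega>) \<partial>M)"
    unfolding law by (subst nn_integral_distr) measurable
  also have "\<dots> = (\<integral>\<^sup>+\<omega>. indicator {x. secure b 0 x (\<Psi> \<omega>)} x \<partial>M)"
    by (intro nn_integral_cong) (auto simp: secure_def A_def S_def h_def indicator_def)
  finally show ?thesis .
qed

end

theorem theorem6p3:
  fixes M :: "'w measure"
    and \<Phi>l \<Phi>e :: "'w \<Rightarrow> point set"
    and lam_l lam_e P \<sigma>l \<sigma>e b :: real
  assumes "prob_space M"
    and "lam_l > 0" and "lam_e > 0"
    and "prob_space.poisson_point_process M lam_l \<Phi>l"
    and "prob_space.poisson_point_process M lam_e \<Phi>e"
    and "prob_space.indep_var M configurations \<Phi>l configurations \<Phi>e"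
    and "P > 0" and "\<sigma>l > 0" and "\<sigma>e > 0" and "\<sigma>l\<^sup>2 = \<sigma>e\<^sup>2"
    and "b > 1"
  defines "Nin \<equiv> \<lambda>\<omega>. N_in (power_law_gain b) P \<sigma>l \<sigma>e 0 (\<Phi>l \<omega>) (\<Phi>e \<omega>)"
    and "Nout \<equiv> \<lambda>\<omega>. N_out (power_law_gain b) P \<sigma>l \<sigma>e 0 (\<Phi>l \<omega>) (\<Phi>e \<omega>)"
  shows "Nin \<in> borel_measurable M \<and> Nout \<in> borel_measurable M \<and>
    (\<integral>\<^sup>+\<omega>. Nin \<omega> \<partial>M) = (\<integral>\<^sup>+\<omega>. Nout \<omega> \<partial>M) \<and>
    (\<integral>\<^sup>+\<omega>. Nout \<omega> \<partial>M) = ennreal (lam_l / lam_e * normalized_sinc (1 / b))"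
proof -
  interpret prob_space M by fact
  let ?out = "\<lambda>(x, E). indicator {x. secure b 0 x E} x :: ennreal"
    and ?in = "\<lambda>(x, E). indicator {x. secure b x 0 E} x :: ennreal"
  \<comment> \<open>These identities hold on the sample space only, where the eavesdropper
    configuration is known to be locally finite.\<close>
  have Nout: "Nout \<omega> = (\<integral>\<^sup>+x. ?out (x, \<Phi>e \<omega>) \<partial>count_space (\<Phi>l \<omega>))"
    and Nin: "Nin \<omega> = (\<integral>\<^sup>+x. ?in (x, \<Phi>e \<omega>) \<partial>count_space (\<Phi>l \<omega>))" if "\<omega> \<in> space M" for \<omega>
    using poisson_point_process_locally_finite[OF assms(5) that] assms(7-10)
    by (simp_all add: Nout_def Nin_def N_out_power_law N_in_power_law)
  note out = measurable_campbell_indep[OF assms(4) less_imp_le[OF assms(2)] assms(6) measurable_secure(1)[of b]]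
    campbell_indep[OF assms(4) less_imp_le[OF assms(2)] assms(6) measurable_secure(1)[of b]]
  note inn = measurable_campbell_indep[OF assms(4) less_imp_le[OF assms(2)] assms(6) measurable_secure(2)[of b]]
    campbell_indep[OF assms(4) less_imp_le[OF assms(2)] assms(6) measurable_secure(2)[of b]]
  have "Nout \<in> borel_measurable M"
    using out(1) by (simp add: Nout cong: measurable_cong)
  moreover have "Nin \<in> borel_measurable M"
    using inn(1) by (simp add: Nin cong: measurable_cong)
  moreover have eq_out: "(\<integral>\<^sup>+\<omega>. Nout \<omega> \<partial>M)
      = ennreal lam_l * (\<integral>\<^sup>+x. \<integral>\<^sup>+\<omega>. indicator {x. secure b 0 x (\<Phi>e \<omega>)} x \<partial>M \<partial>lborel)"
    using out(2) by (simp add: Nout cong: nn_integral_cong)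
  moreover have "(\<integral>\<^sup>+\<omega>. Nin \<omega> \<partial>M) = (\<integral>\<^sup>+\<omega>. Nout \<omega> \<partial>M)"
    unfolding eq_out using inn(2) by (simp add: Nin secure_prob_swap[OF assms(5)] cong: nn_integral_cong)
  moreover have "(\<integral>\<^sup>+\<omega>. Nout \<omega> \<partial>M) = ennreal (lam_l / lam_e * normalized_sinc (1 / b))"
    unfolding eq_out expected_secure_area[OF assms(5,3,11)]
    using assms(2) by (simp add: ennreal_mult'[symmetric])
  ultimately show ?thesis by blast
qed

end
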